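(* Let $n\ge 1$, let $\alpha\in(-\frac1n,0]$, and let $f,g,h\in C_\alpha(\mathbb{R}^n)$. Then $$\|f\|_1\,\|g\star_\alpha\bar h\|_1\le\frac{1}{2^n}\prod_{j=1}^n\left(\frac{2+j\alpha}{1+j\alpha}\right)^2\|f\star_\alpha\bar g\|_1\,\|f\star_\alpha\bar h\|_1 .$$
   Context: For $\alpha\in(-\infty,0]$, a function $f:\mathbb{R}^n\to[0,\infty)$ is $\alpha$-concave if for all $x,y$ with $f(x),f(y)>0$ and all $\lambda\in[0,1]$, $f(\lambda x+(1-\lambda)y)\ge[\lambda f(x)^\alpha+(1-\lambda)f(y)^\alpha]^{1/\alpha}$, where the right side is read as $f(x)^\lambda f(y)^{1-\lambda}$ for $\alpha=0$. $C_\alpha(\mathbb{R}^n)$ is the set of upper semicontinuous $\alpha$-concave $f:\mathbb{R}^n\to[0,\infty)$ with $\|f\|_\infty=f(0)=1$ and $\lim_{|x|\to\infty}f(x)=0$. The $\alpha$-sum is $(f\star_\alpha g)(x)=\sup_{y+z=x}(f(y)^\alpha+g(z)^\alpha-1)^{1/\alpha}$ for $-\infty<\alpha<0$ (the expression is $0$ whenever $f(y)=0$ or $g(z)=0$), and $(f\star_0 g)(x)=\sup_{y+z=x}f(y)g(z)$. $\bar g(x)=g(-x)$. $\|f\|_1=\int_{\mathbb{R}^n}f(x)\,dx$ for $f\ge0$. *)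

theory Defs
  imports "HOL-Analysis.Analysis"
begin

definition upper_semicontinuous :: "('a::topological_space \<Rightarrow> real) \<Rightarrow> bool" where
  "upper_semicontinuous f \<longleftrightarrow> (\<forall>x c. f x < c \<longrightarrow> (\<forall>\<^sub>F y in nhds x. f y < c))"

text \<open>Only used for \<^term>\<open>a > 0\<close> and \<^term>\<open>b > 0\<close>, so \<open>powr\<close> is the usual real power.\<close>

definition alpha_mean :: "real \<Rightarrow> real \<Rightarrow> real \<Rightarrow> real \<Rightarrow> real" where
  "alpha_mean \<alpha> l a b =
     (if \<alpha> = 0 then a powr l * b powr (1 - l)
      else (l * a powr \<alpha> + (1 - l) * b powr \<alpha>) powr (1 / \<alpha>))"

definition alpha_concave :: "real \<Rightarrow> ('a::real_vector \<Rightarrow> real) \<Rightarrow> bool" where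
  "alpha_concave \<alpha> f \<longleftrightarrow>
     (\<forall>x y. f x > 0 \<longrightarrow> f y > 0 \<longrightarrow>
       (\<forall>l\<in>{0..1}. f (l *\<^sub>R x + (1 - l) *\<^sub>R y) \<ge> alpha_mean \<alpha> l (f x) (f y)))"

text \<open>
  The norms take values in \<open>[0, \<infinity>]\<close>, so that no boundedness or integrability has to be
  presupposed. The sup norm is the pointwise supremum, not the essential one.
\<close>

definition sup_norm :: "('a \<Rightarrow> real) \<Rightarrow> ennreal" where
  "sup_norm f = (SUP x. ennreal \<bar>f x\<bar>)"

definition L1_norm :: "('a::euclidean_space \<Rightarrow> real) \<Rightarrow> ennreal" where
  "L1_norm f = (\<integral>\<^sup>+ x. ennreal \<bar>f x\<bar> \<partial>lborel)"

definition C_alpha :: "real \<Rightarrow> ('a::euclidean_space \<Rightarrow> real) set" where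
  "C_alpha \<alpha> =
     {f. (\<forall>x. f x \<ge> 0) \<and> upper_semicontinuous f \<and> alpha_concave \<alpha> f \<and>
         sup_norm f = ennreal (f 0) \<and> f 0 = 1 \<and> (f \<longlongrightarrow> 0) at_infinity}"

text \<open>
  The value 0 is imposed explicitly when an argument vanishes, because \<^term>\<open>0 powr \<alpha> = 0\<close>
  whereas the intended reading of \<open>0\<^sup>\<alpha>\<close> for \<^term>\<open>\<alpha> < 0\<close> is \<open>+\<infinity>\<close>.
\<close>

definition alpha_prod :: "real \<Rightarrow> real \<Rightarrow> real \<Rightarrow> real" where
  "alpha_prod \<alpha> a b =
     (if \<alpha> = 0 then a * b
      else if a = 0 \<or> b = 0 then 0
      else (a powr \<alpha> + b powr \<alpha> - 1) powr (1 / \<alpha>))"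

text \<open>
  For \<^term>\<open>f \<in> C_alpha \<alpha>\<close>, \<^term>\<open>g \<in> C_alpha \<alpha>\<close> and \<^term>\<open>\<alpha> \<le> 0\<close> both functions have
  values in \<open>[0, 1]\<close>; hence the base \<open>f(y)\<^sup>\<alpha> + g(z)\<^sup>\<alpha> - 1\<close> is at least 1
  and the real supremum below is taken over a nonempty subset of \<open>[0, 1]\<close>.
\<close>

definition alpha_sum ::
  "real \<Rightarrow> ('a::real_vector \<Rightarrow> real) \<Rightarrow> ('a \<Rightarrow> real) \<Rightarrow> 'a \<Rightarrow> real" where
  "alpha_sum \<alpha> f g x = Sup {alpha_prod \<alpha> (f y) (g z) | y z. y + z = x}"

definition reflect :: "('a::real_vector \<Rightarrow> real) \<Rightarrow> 'a \<Rightarrow> real" where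
  "reflect g x = g (- x)"

end

theory Submission
  imports Defs "HOL-Real_Asymp.Real_Asymp"
begin

text \<open>
  The starting point is Ruzsa's triangle inequality \<open>|A| |B - C| \<le> |A - B| |A - C|\<close>: if \<open>x = b - c\<close>,
  then \<open>a - b\<close> and \<open>a - c\<close> differ by \<open>x\<close> for every \<open>a \<in> A\<close>. For functions write \<open>T\<close>, \<open>F\<close>, \<open>H\<close> for
  the \<open>\<alpha>\<close>-sums of \<open>g\<close> and reflected \<open>h\<close>, of \<open>f\<close> and reflected \<open>g\<close>, of \<open>f\<close> and reflected \<open>h\<close>, and
  let \<open>G\<close> be the square of the \<open>\<alpha>\<close>-mean, with equal weights, of its argument and 1 (and 0 at 0). The pointwise
  inequality \<open>p\<^sup>2 G (q \<cdot> r) \<le> (p \<cdot> q) (p \<cdot> r)\<close> for the \<open>\<alpha>\<close>-product on \<open>[0, 1]\<close> turns Ruzsa's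
  argument into
  
    \<open>(\<integral> f\<^sup>2) (\<integral> G \<circ> T) \<le> (\<integral> F) (\<integral> H)\<close>
  
  (lemma \<open>alpha_sum_triangle\<close>). It remains to bound \<open>\<integral> f\<close> by \<open>\<integral> f\<^sup>2\<close> and \<open>\<integral> T\<close> by \<open>\<integral> G \<circ> T\<close>.
  The second bound is available because \<open>T\<close> lies in the same class
  (theorem \<open>alpha_sum_C_alpha\<close>).
  
  For \<open>\<alpha> < 0\<close> put \<open>\<theta> = f\<^sup>\<alpha> - 1\<close> and \<open>b = - 1 / \<alpha> > n\<close>. Then \<open>\<theta>\<close> is convex with \<open>\<theta> 0 = 0\<close>, and
  \<open>f\<close>, \<open>f\<^sup>2\<close>, \<open>G \<circ> f\<close> are \<open>(1 + \<theta>)\<^sup>-\<^sup>b\<close>, \<open>(1 + \<theta>)\<^sup>-\<^sup>2\<^sup>b\<close>, \<open>(1 + \<theta> / 2)\<^sup>-\<^sup>2\<^sup>b\<close>. Both bounds are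
  instances of
  
    \<open>\<integral> (1 + \<theta>)\<^sup>-\<^sup>b \<le> c\<^sup>n (\<Prod>j = 1..n. (2 + j \<alpha>) / (1 + j \<alpha>)) \<integral> (1 + c \<theta>)\<^sup>-\<^sup>2\<^sup>b\<close>  for \<open>c \<ge> 1 / 2\<close>
  
  (lemma \<open>L1_norm_le_dilated_power\<close>), with \<open>c = 1\<close> and \<open>c = 1 / 2\<close>; multiplying the two constants gives
  the constant of the theorem. Equality holds for \<open>\<theta>\<close> homogeneous of degree 1, and the general case reduces
  to it: the volume of \<open>{\<theta> \<le> t}\<close> divided by \<open>t\<^sup>n\<close> is nonincreasing, and the
  two layer-cake weights cross exactly once. For \<open>\<alpha> = 0\<close> the function \<open>G\<close> is the identity and
  \<open>f (2 x) \<le> (f x)\<^sup>2\<close> gives the remaining bound.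
\<close>

section \<open>Moments and crossings of power weights\<close>

text \<open>
  Integration by parts lowers both the exponent \<open>n\<close> and the decay rate \<open>b\<close> by one. Hence
  \<open>t\<^sup>n (1 + t)\<^sup>-\<^sup>b\<^sup>-\<^sup>1\<close> has an antiderivative that vanishes at infinity, and its value at 0 is minus
  the Beta integral. An antiderivative is what the fundamental theorem for
  nonnegative integrals on a half-line needs.
\<close>

lemma powr_moment_antiderivative:
  fixes b :: real
  assumes "real n < b"
  shows "\<exists>F. (\<forall>t\<ge>0. (F has_real_derivative t ^ n * (1 + t) powr (- b - 1)) (at t)) \<and>
    (F \<longlongrightarrow> 0) at_top \<and> F 0 = - fact n / (\<Prod>j\<le>n. b - real j)"
  using assms
proof (induction n arbitrary: b)
  case 0
  have "((\<lambda>t. - ((1 + t) powr (- b)) / b) \<longlongrightarrow> 0) at_top"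
    using 0 by real_asymp
  moreover have "((\<lambda>t. - ((1 + t) powr (- b)) / b) has_real_derivative (1 + t) powr (- b - 1)) (at t)"
    if "t \<ge> 0" for t
    using that 0 by (auto intro!: derivative_eq_intros)
  ultimately show ?case
    by (intro exI[of _ "\<lambda>t. - ((1 + t) powr (- b)) / b"]) auto
next
  case (Suc n)
  from Suc.prems have "real n < b - 1" "b > 0" by auto
  from Suc.IH[OF this(1)] obtain F where
    F: "\<And>t. t \<ge> 0 \<Longrightarrow> (F has_real_derivative t ^ n * (1 + t) powr (- b)) (at t)"
       "(F \<longlongrightarrow> 0) at_top" "F 0 = - fact n / (\<Prod>j\<le>n. (b - 1) - real j)"
    by auto
  define G where "G t = - (t ^ Suc n * (1 + t) powr (- b)) / b + (real (Suc n) / b) * F t" for t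
  have "(G has_real_derivative t ^ Suc n * (1 + t) powr (- b - 1)) (at t)" if t: "t \<ge> 0" for t
  proof -
    have "((\<lambda>t. t ^ Suc n * (1 + t) powr (- b)) has_real_derivative
        real (Suc n) * t ^ n * (1 + t) powr (- b) - b * (t ^ Suc n * (1 + t) powr (- b - 1))) (at t)"
    proof -
      have "((\<lambda>t. (1 + t) powr (- b)) has_real_derivative - b * (1 + t) powr (- b - 1)) (at t)"
        using t by (auto intro!: derivative_eq_intros)
      from DERIV_mult[OF DERIV_pow[of "Suc n" t UNIV] this] show ?thesis
        by (rule DERIV_cong) (simp add: algebra_simps)
    qed
    from DERIV_add[OF DERIV_cdivide[OF DERIV_minus[OF this], of b] DERIV_cmult[OF F(1)[OF t], of "real (Suc n) / b"]]
    show ?thesis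
      unfolding G_def by (rule DERIV_cong) (use \<open>b > 0\<close> in \<open>simp add: field_simps\<close>)
  qed
  moreover have "(G \<longlongrightarrow> 0) at_top"
  proof -
    have "((\<lambda>t. (1 + t) powr (real (Suc n) - b)) \<longlongrightarrow> 0) at_top"
      using Suc.prems by real_asymp
    moreover have "\<forall>\<^sub>F t in at_top. norm (t ^ Suc n * (1 + t) powr (- b)) \<le> (1 + t) powr (real (Suc n) - b)"
      using eventually_ge_at_top[of 0]
    proof eventually_elim
      case (elim t)
      have "t ^ Suc n \<le> (1 + t) ^ Suc n" using elim by (intro power_mono) auto
      also have "\<dots> = (1 + t) powr real (Suc n)" using elim by (subst powr_realpow) auto
      finally have "t ^ Suc n * (1 + t) powr (- b) \<le> (1 + t) powr real (Suc n) * (1 + t) powr (- b)"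
        by (intro mult_right_mono) auto
      then show ?case using elim by (simp flip: powr_add)
    qed
    ultimately have "((\<lambda>t. t ^ Suc n * (1 + t) powr (- b)) \<longlongrightarrow> 0) at_top"
      by (rule Lim_null_comparison[rotated])
    from tendsto_add[OF tendsto_divide[OF tendsto_minus[OF this] tendsto_const[of b]]
        tendsto_mult[OF tendsto_const[of "real (Suc n) / b"] F(2)]]
    show ?thesis using \<open>b > 0\<close> unfolding G_def by simp
  qed
  moreover have "G 0 = - fact (Suc n) / (\<Prod>j\<le>Suc n. b - real j)"
    unfolding G_def F(3) prod.atMost_Suc_shift using \<open>b > 0\<close>
    by (simp add: field_simps) (simp add: minus_divide_left)
  ultimately show ?case by blast
qed

lemma nn_integral_powr_moment:
  fixes b c :: real
  assumes "real n < b" and "c > 0"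
  shows "(\<integral>\<^sup>+t. ennreal (t ^ n * (1 + c * t) powr (- b - 1)) * indicator {0..} t \<partial>lborel)
    = ennreal (fact n / (c ^ Suc n * (\<Prod>j\<le>n. b - real j)))"
proof -
  from powr_moment_antiderivative[OF assms(1)] obtain F where
    F: "\<And>t. t \<ge> 0 \<Longrightarrow> (F has_real_derivative t ^ n * (1 + t) powr (- b - 1)) (at t)"
       "(F \<longlongrightarrow> 0) at_top" "F 0 = - fact n / (\<Prod>j\<le>n. b - real j)"
    by auto
  define G where "G t = F (c * t) / c ^ Suc n" for t
  have *: "(G has_real_derivative t ^ n * (1 + c * t) powr (- b - 1)) (at t)" if "t \<ge> 0" for t
  proof -
    have "((\<lambda>t. F (c * t)) has_real_derivative ((c * t) ^ n * (1 + c * t) powr (- b - 1)) * c) (at t)"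
      by (rule DERIV_chain2[OF F(1)]) (use that assms(2) in \<open>auto intro!: derivative_eq_intros\<close>)
    from DERIV_cdivide[OF this, of "c ^ Suc n"] show ?thesis
      unfolding G_def using assms(2) by (simp add: power_mult_distrib field_simps)
  qed
  have "filterlim (\<lambda>t. c * t) at_top at_top"
    using assms(2) by real_asymp
  from filterlim_compose[OF F(2) this] have "(G \<longlongrightarrow> 0 / c ^ Suc n) at_top"
    unfolding G_def by (intro tendsto_divide) (use assms(2) in auto)
  then have "(\<integral>\<^sup>+t. ennreal (t ^ n * (1 + c * t) powr (- b - 1)) * indicator {0..} t \<partial>lborel) = ennreal (0 - G 0)"
    using assms(2) by (intro nn_integral_FTC_atLeast *) auto
  also have "0 - G 0 = fact n / (c ^ Suc n * (\<Prod>j\<le>n. b - real j))"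
    unfolding G_def by (simp add: F(3) field_simps)
  finally show ?thesis .
qed

text \<open>
  The two weights come from the layer-cake formula for \<open>(1 + \<theta>)\<^sup>-\<^sup>b\<close> and \<open>(1 + c \<theta>)\<^sup>-\<^sup>2\<^sup>b\<close>. Substituting
  \<open>1 + t = v\<^sup>p\<close> with \<open>p = (2 b + 1) / (b + 1) > 1\<close> and taking the root of order \<open>2 b + 1\<close> turns
  their comparison into the sign of \<open>d v = 1 + c (v\<^sup>p - 1) - M v\<close>. This is a convex function
  that is negative at \<open>v = 1\<close>, by the condition on \<open>C\<close>, and tends to infinity, so it
  changes sign exactly once on \<open>v \<ge> 1\<close>.
\<close>

lemma single_crossing_powr:
  fixes b c C :: real
  assumes b: "b > 0" and c: "c > 0" and C: "2 * c * C > 1"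
  obtains t\<^sub>0 where "t\<^sub>0 > 0"
    "\<And>t. 0 \<le> t \<Longrightarrow> t \<le> t\<^sub>0 \<Longrightarrow> b * (1 + t) powr (- b - 1) \<le> C * (2 * b * c * (1 + c * t) powr (- 2 * b - 1))"
    "\<And>t. t\<^sub>0 \<le> t \<Longrightarrow> C * (2 * b * c * (1 + c * t) powr (- 2 * b - 1)) \<le> b * (1 + t) powr (- b - 1)"
proof -
  define p where "p = (2 * b + 1) / (b + 1)"
  define M where "M = (2 * c * C) powr (1 / (2 * b + 1))"
  define d where "d v = 1 + c * (v powr p - 1) - M * v" for v
  have p: "p > 1" "p * (b + 1) = 2 * b + 1" "p - 1 = b / (b + 1)"
    using b by (auto simp: p_def field_simps)
  have M: "M > 1" using b C by (simp add: M_def)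
  have MC: "M powr (2 * b + 1) = 2 * c * C" using b c C unfolding M_def by (simp add: powr_powr)
  have cancel: "x powr (2 * b + 1) \<le> y powr (2 * b + 1) \<longleftrightarrow> x \<le> y" if "x > 0" "y > 0" for x y :: real
    using that b powr_mono2[of "2 * b + 1" x y] powr_less_mono2[of "2 * b + 1" y x] by linarith
  have key: "b * (1 + t) powr (- b - 1) \<le> C * (2 * b * c * (1 + c * t) powr (- 2 * b - 1))
      \<longleftrightarrow> d ((1 + t) powr (1 / p)) \<le> 0"
    and key2: "C * (2 * b * c * (1 + c * t) powr (- 2 * b - 1)) \<le> b * (1 + t) powr (- b - 1)
      \<longleftrightarrow> d ((1 + t) powr (1 / p)) \<ge> 0" if t: "t \<ge> 0" for t
  proof -
    define v where "v = (1 + t) powr (1 / p)"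
    have v: "v > 0" "v powr p = 1 + t" using t p by (auto simp: v_def powr_powr)
    have e: "(M * v) powr (2 * b + 1) = (2 * c * C) * (1 + t) powr (b + 1)"
    proof -
      have "v powr (2 * b + 1) = (1 + t) powr (b + 1)"
        unfolding p(2)[symmetric] v(2)[symmetric] by (simp add: powr_powr)
      then show ?thesis using v M by (simp add: powr_mult MC)
    qed
    have ct: "1 + c * t > 0" using c t by (simp add: add_pos_nonneg)
    have dv: "d v = (1 + c * t) - M * v" by (simp add: d_def v)
    have a1: "(1 + t) powr (- b - 1) = 1 / (1 + t) powr (b + 1)"
      by (simp add: powr_minus_divide[symmetric])
    have a2: "(1 + c * t) powr (- 2 * b - 1) = 1 / (1 + c * t) powr (2 * b + 1)"
      by (simp add: powr_minus_divide[symmetric])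
    have pos: "(1 + t) powr (b + 1) > 0" "(1 + c * t) powr (2 * b + 1) > 0" using t ct by auto
    have "b * (1 + t) powr (- b - 1) \<le> C * (2 * b * c * (1 + c * t) powr (- 2 * b - 1))
       \<longleftrightarrow> (1 + c * t) powr (2 * b + 1) \<le> (M * v) powr (2 * b + 1)"
      unfolding e a1 a2 using pos b by (simp add: field_simps)
    also have "\<dots> \<longleftrightarrow> 1 + c * t \<le> M * v"
      using ct M v b by (intro cancel) auto
    finally show "b * (1 + t) powr (- b - 1) \<le> C * (2 * b * c * (1 + c * t) powr (- 2 * b - 1))
      \<longleftrightarrow> d ((1 + t) powr (1 / p)) \<le> 0" using dv unfolding v_def by simp
    have "C * (2 * b * c * (1 + c * t) powr (- 2 * b - 1)) \<le> b * (1 + t) powr (- b - 1)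
       \<longleftrightarrow> (M * v) powr (2 * b + 1) \<le> (1 + c * t) powr (2 * b + 1)"
      unfolding e a1 a2 using pos b by (simp add: field_simps)
    also have "\<dots> \<longleftrightarrow> M * v \<le> 1 + c * t"
      using ct M v b by (intro cancel) auto
    finally show "C * (2 * b * c * (1 + c * t) powr (- 2 * b - 1)) \<le> b * (1 + t) powr (- b - 1)
      \<longleftrightarrow> d ((1 + t) powr (1 / p)) \<ge> 0" using dv unfolding v_def by simp
  qed
  have conv: "convex_on {0<..} d"
  proof -
    have 1: "convex_on {0<..} (\<lambda>v. c * v powr p)"
      using p c by (intro convex_on_cmul powr_convex) auto
    have 2: "convex_on {0<..} (\<lambda>v. 1 - c - M * v)"
      by (auto simp: convex_on_def algebra_simps simp flip: distrib_left) (metis add.commute distrib_right mult.commute mult.left_neutral order_refl)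
    show ?thesis using convex_on_add[OF 1 2] unfolding d_def by (simp add: algebra_simps)
  qed
  have d1: "d 1 < 0" using M by (simp add: d_def)
  \<comment> \<open>By the choice of \<open>T\<close>, \<open>c T\<^sup>p \<ge> (M + c) T\<close>: beyond \<open>T\<close> the power has overtaken the linear term.\<close>
  define T where "T = max 2 (((M + c) / c) powr (1 / (p - 1)))"
  have T: "T \<ge> 2" "T powr (p - 1) \<ge> (M + c) / c"
  proof -
    show "T \<ge> 2" by (simp add: T_def)
    have "(M + c) / c = (((M + c) / c) powr (1 / (p - 1))) powr (p - 1)"
      using p(1) M c by (simp add: powr_powr)
    also have "\<dots> \<le> T powr (p - 1)" using p by (intro powr_mono2) (auto simp: T_def)
    finally show "T powr (p - 1) \<ge> (M + c) / c" .
  qed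
  have dT: "d T \<ge> 0"
  proof -
    have "T powr p = T powr (p - 1) * T" using T by (simp add: powr_diff)
    moreover have "(M + c) / c * T \<le> T powr (p - 1) * T" using T by (intro mult_right_mono) auto
    ultimately have "c * T powr p \<ge> c * ((M + c) / c * T)" using c by (intro mult_left_mono) auto
    also have "c * ((M + c) / c * T) = M * T + c * T" using c by (simp add: field_simps)
    finally have "c * T powr p \<ge> M * T + c * T" .
    moreover have "c * T \<ge> c" using T c by simp
    ultimately show ?thesis by (simp add: d_def algebra_simps)
  qed
  have "\<exists>v\<ge>1. v \<le> T \<and> d v = 0"
  proof (rule IVT')
    show "continuous_on {1..T} d" unfolding d_def by (intro continuous_intros) auto
  qed (use d1 dT T in auto)
  then obtain v\<^sub>0 where v0: "v\<^sub>0 \<ge> 1" "d v\<^sub>0 = 0" by auto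
  with d1 have v01: "v\<^sub>0 > 1" by (cases "v\<^sub>0 = 1") auto
  have le: "d v \<le> 0" if "1 \<le> v" "v \<le> v\<^sub>0" for v
  proof -
    have "d v \<le> max (d 1) (d v\<^sub>0)"
      using that by (intro convex_on_le_max[of _ _ ] convex_on_subset[OF conv]) auto
    then show ?thesis using v0 d1 by simp
  qed
  have ge: "d v \<ge> 0" if "v\<^sub>0 \<le> v" for v
  proof (rule ccontr)
    assume "\<not> d v \<ge> 0"
    then have "d v < 0" by simp
    have "d v\<^sub>0 \<le> max (d 1) (d v)"
      using that v01 by (intro convex_on_le_max[of _ _ ] convex_on_subset[OF conv]) auto
    then show False using v0 d1 \<open>d v < 0\<close> by simp
  qed
  show ?thesis
  proof (rule that[of "v\<^sub>0 powr p - 1"])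
    show "0 < v\<^sub>0 powr p - 1" using v01 p by simp
    have v0p: "(v\<^sub>0 powr p) powr (1 / p) = v\<^sub>0" using v0 p by (simp add: powr_powr)
    fix t :: real
    { assume t: "0 \<le> t" "t \<le> v\<^sub>0 powr p - 1"
      have "(1 + t) powr (1 / p) \<le> (v\<^sub>0 powr p) powr (1 / p)"
        using t p by (intro powr_mono2) auto
      moreover have "(1 + t) powr (1 / p) \<ge> 1" using t p by (intro ge_one_powr_ge_zero) auto
      ultimately show "b * (1 + t) powr (- b - 1) \<le> C * (2 * b * c * (1 + c * t) powr (- 2 * b - 1))"
        using key[OF t(1)] le v0p by simp }
    { assume t: "v\<^sub>0 powr p - 1 \<le> t"
      have "v\<^sub>0 powr p \<ge> 1" using v01 p by (intro ge_one_powr_ge_zero) auto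
      then have t0: "t \<ge> 0" using t by simp
      have "(v\<^sub>0 powr p) powr (1 / p) \<le> (1 + t) powr (1 / p)"
        using t p by (intro powr_mono2) auto
      then show "C * (2 * b * c * (1 + c * t) powr (- 2 * b - 1)) \<le> b * (1 + t) powr (- b - 1)"
        using key2[OF t0] ge v0p by simp }
  qed
qed

text \<open>
  A Chebyshev-type argument. The quotient \<open>v t / t\<^sup>n\<close> is nonincreasing, so replacing it by
  its value \<open>k\<close> at the crossing point \<open>t\<^sub>0\<close> favours \<open>w\<^sub>1\<close> on both sides of \<open>t\<^sub>0\<close>:
  \<open>(v t - k t\<^sup>n) (w\<^sub>1 t - w\<^sub>2 t) \<le> 0\<close> everywhere. Integrating leaves only the equal \<open>n\<close>-th moments,
  which cancel because they are finite.
\<close>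

lemma nn_integral_le_of_single_crossing:
  fixes v w\<^sub>1 w\<^sub>2 :: "real \<Rightarrow> real"
  assumes [measurable]: "v \<in> borel_measurable borel" "w\<^sub>1 \<in> borel_measurable borel" "w\<^sub>2 \<in> borel_measurable borel"
    and v: "\<And>t. 0 \<le> t \<Longrightarrow> 0 \<le> v t"
    and v_scale: "\<And>s t. 0 \<le> s \<Longrightarrow> s \<le> t \<Longrightarrow> v t * s ^ n \<le> v s * t ^ n"
    and w: "\<And>t. 0 \<le> t \<Longrightarrow> 0 \<le> w\<^sub>1 t" "\<And>t. 0 \<le> t \<Longrightarrow> 0 \<le> w\<^sub>2 t"
    and t\<^sub>0: "t\<^sub>0 > 0"
    and below: "\<And>t. 0 \<le> t \<Longrightarrow> t \<le> t\<^sub>0 \<Longrightarrow> w\<^sub>1 t \<le> w\<^sub>2 t"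
    and above: "\<And>t. t\<^sub>0 \<le> t \<Longrightarrow> w\<^sub>2 t \<le> w\<^sub>1 t"
    and moment: "(\<integral>\<^sup>+t. ennreal (t ^ n * w\<^sub>1 t) * indicator {0..} t \<partial>lborel)
      = (\<integral>\<^sup>+t. ennreal (t ^ n * w\<^sub>2 t) * indicator {0..} t \<partial>lborel)"
    and fin: "(\<integral>\<^sup>+t. ennreal (t ^ n * w\<^sub>2 t) * indicator {0..} t \<partial>lborel) < \<infinity>"
  shows "(\<integral>\<^sup>+t. ennreal (v t * w\<^sub>1 t) * indicator {0..} t \<partial>lborel)
      \<le> (\<integral>\<^sup>+t. ennreal (v t * w\<^sub>2 t) * indicator {0..} t \<partial>lborel)"
proof -
  define k where "k = v t\<^sub>0 / t\<^sub>0 ^ n"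
  have k: "k \<ge> 0" using v t\<^sub>0 by (simp add: k_def)
  let ?I = "\<lambda>u. \<integral>\<^sup>+t. ennreal (u t) * indicator {0..} t \<partial>lborel"
  have pt: "v t * w\<^sub>1 t + k * (t ^ n * w\<^sub>2 t) \<le> v t * w\<^sub>2 t + k * (t ^ n * w\<^sub>1 t)" if t: "0 \<le> t" for t
  proof (cases "t \<le> t\<^sub>0")
    case True
    from v_scale[OF t True] have "k * t ^ n \<le> v t"
      using t\<^sub>0 by (simp add: k_def field_simps)
    then have "(v t - k * t ^ n) * (w\<^sub>2 t - w\<^sub>1 t) \<ge> 0" using below[OF t True] by simp
    then show ?thesis by (simp add: algebra_simps)
  next
    case False
    then have "t\<^sub>0 \<le> t" by simp
    from v_scale[OF _ this] have "v t \<le> k * t ^ n"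
      using t\<^sub>0 by (simp add: k_def field_simps)
    then have "(k * t ^ n - v t) * (w\<^sub>1 t - w\<^sub>2 t) \<ge> 0" using above[OF \<open>t\<^sub>0 \<le> t\<close>] by simp
    then show ?thesis by (simp add: algebra_simps)
  qed
  have add: "?I (\<lambda>t. v t * u t + k * (t ^ n * u' t)) = ?I (\<lambda>t. v t * u t) + ennreal k * ?I (\<lambda>t. t ^ n * u' t)"
    if [measurable]: "u \<in> borel_measurable borel" "u' \<in> borel_measurable borel"
      and "\<And>t. 0 \<le> t \<Longrightarrow> 0 \<le> u t" "\<And>t. 0 \<le> t \<Longrightarrow> 0 \<le> u' t" for u u'
  proof -
    have "?I (\<lambda>t. v t * u t + k * (t ^ n * u' t))
      = (\<integral>\<^sup>+t. ennreal (v t * u t) * indicator {0..} t + ennreal k * (ennreal (t ^ n * u' t) * indicator {0..} t) \<partial>lborel)"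
      using that v k by (intro nn_integral_cong) (auto simp: indicator_def ennreal_plus ennreal_mult)
    also have "\<dots> = ?I (\<lambda>t. v t * u t) + ennreal k * ?I (\<lambda>t. t ^ n * u' t)"
      by (subst nn_integral_add) (auto simp: nn_integral_cmult)
    finally show ?thesis .
  qed
  have "?I (\<lambda>t. v t * w\<^sub>1 t + k * (t ^ n * w\<^sub>2 t)) \<le> ?I (\<lambda>t. v t * w\<^sub>2 t + k * (t ^ n * w\<^sub>1 t))"
    using pt by (intro nn_integral_mono) (auto simp: indicator_def intro!: ennreal_leI)
  then have "?I (\<lambda>t. v t * w\<^sub>1 t) + ennreal k * ?I (\<lambda>t. t ^ n * w\<^sub>2 t)
      \<le> ?I (\<lambda>t. v t * w\<^sub>2 t) + ennreal k * ?I (\<lambda>t. t ^ n * w\<^sub>2 t)"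
    using w by (simp add: add moment)
  moreover have "ennreal k * ?I (\<lambda>t. t ^ n * w\<^sub>2 t) < \<infinity>"
    using fin by (simp add: ennreal_mult_less_top)
  ultimately show ?thesis
    by (auto simp: ennreal_add_left_cancel_le add.commute[of _ "ennreal k * _"])
qed

section \<open>Functions of the class\<close>

lemma upper_semicontinuous_borel_measurable:
  assumes "upper_semicontinuous f"
  shows "f \<in> borel_measurable borel"
proof (rule borel_measurable_iff_less[THEN iffD2], intro allI)
  fix c
  have "open {x. f x < c}"
    unfolding open_subopen[of "{x. f x < c}"]
  proof safe
    fix x assume "f x < c"
    then have "\<forall>\<^sub>F y in nhds x. f y < c"
      using assms unfolding upper_semicontinuous_def by blast
    then show "\<exists>T. open T \<and> x \<in> T \<and> T \<subseteq> {x. f x < c}"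
      unfolding eventually_nhds by blast
  qed
  then show "{x \<in> space borel. f x < c} \<in> sets borel" by simp
qed

lemma
  assumes "f \<in> C_alpha \<alpha>"
  shows C_alpha_nonneg: "0 \<le> f x"
    and C_alpha_at_0: "f 0 = 1"
    and C_alpha_le_1: "f x \<le> 1"
    and C_alpha_usc: "upper_semicontinuous f"
    and C_alpha_borel: "f \<in> borel_measurable borel"
    and C_alpha_tendsto: "(f \<longlongrightarrow> 0) at_infinity"
    and C_alpha_concave: "alpha_concave \<alpha> f"
proof -
  show "0 \<le> f x" "f 0 = 1" "upper_semicontinuous f" "(f \<longlongrightarrow> 0) at_infinity" "alpha_concave \<alpha> f"
    using assms by (auto simp: C_alpha_def)
  then show "f \<in> borel_measurable borel" by (intro upper_semicontinuous_borel_measurable)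
  have "ennreal \<bar>f x\<bar> \<le> sup_norm f" unfolding sup_norm_def by (rule SUP_upper) simp
  then have "ennreal (f x) \<le> 1" using assms \<open>0 \<le> f x\<close> by (auto simp: C_alpha_def)
  then show "f x \<le> 1" by simp
qed

lemma C_alpha_bounded_superlevel:
  fixes f :: "'a::euclidean_space \<Rightarrow> real"
  assumes "f \<in> C_alpha \<alpha>" "c > 0"
  shows "bounded {x. f x \<ge> c}"
proof -
  have "\<forall>\<^sub>F x in at_infinity. f x < c"
    using order_tendstoD(2)[OF C_alpha_tendsto[OF assms(1)] assms(2)] .
  then obtain R where "\<And>x. R \<le> norm x \<Longrightarrow> f x < c" by (auto simp: eventually_at_infinity)
  then have "norm x \<le> R" if "f x \<ge> c" for x using that by (metis linorder_not_less nle_le)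
  then show ?thesis by (auto simp: bounded_iff)
qed

lemma C_alpha_radial:
  assumes "f \<in> C_alpha \<alpha>" "f x > 0" "0 \<le> l" "l \<le> 1"
  shows "alpha_mean \<alpha> l (f x) 1 \<le> f (l *\<^sub>R x)"
proof -
  have "alpha_mean \<alpha> l (f x) (f 0) \<le> f (l *\<^sub>R x + (1 - l) *\<^sub>R 0)"
    using C_alpha_concave[OF assms(1), unfolded alpha_concave_def, rule_format, of x 0 l]
      C_alpha_at_0[OF assms(1)] assms(2-) by simp
  then show ?thesis using C_alpha_at_0[OF assms(1)] by simp
qed

lemma powr_inverse_le_iff:
  fixes \<alpha> a b :: real
  assumes "\<alpha> < 0" "a > 0" "b > 0"
  shows "b powr (1 / \<alpha>) \<le> a \<longleftrightarrow> a powr \<alpha> \<le> b"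
proof -
  have "(b powr (1 / \<alpha>)) powr \<alpha> = b" using assms by (simp add: powr_powr)
  then show ?thesis
    using powr_mono2'[of \<alpha> "b powr (1 / \<alpha>)" a] powr_less_mono2_neg[of \<alpha> a "b powr (1 / \<alpha>)"] assms
    by (smt (verit) powr_gt_zero)
qed

lemma one_le_powr_neg: "\<alpha> \<le> 0 \<Longrightarrow> 0 < a \<Longrightarrow> a \<le> 1 \<Longrightarrow> 1 \<le> a powr \<alpha>" for a \<alpha> :: real
  using powr_mono2'[of \<alpha> a 1] by simp

section \<open>Sublevel volumes and the integral comparison\<close>

lemma nn_integral_lborel_scaleR:
  fixes f :: "'a::euclidean_space \<Rightarrow> ennreal"
  assumes [measurable]: "f \<in> borel_measurable borel" and "c \<noteq> 0"
  shows "(\<integral>\<^sup>+x. f x \<partial>lborel) = ennreal (\<bar>c\<bar> ^ DIM('a)) * (\<integral>\<^sup>+x. f (c *\<^sub>R x) \<partial>lborel)"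
  by (subst lborel_affine[OF assms(2), of 0])
    (simp add: nn_integral_density nn_integral_distr nn_integral_cmult)

text \<open>
  For \<open>\<alpha> < 0\<close>, \<open>\<alpha>\<close>-concavity of \<open>f\<close> means that \<open>\<theta> = f\<^sup>\<alpha> - 1\<close> is convex, with the value \<open>\<infinity>\<close>
  where \<open>f\<close> vanishes. The set \<open>{\<theta> \<le> t}\<close> must therefore leave out the zeros of \<open>f\<close>, at which
  \<open>powr\<close> would give \<open>\<theta> = - 1\<close>.
\<close>

definition sublevel :: "real \<Rightarrow> ('a \<Rightarrow> real) \<Rightarrow> real \<Rightarrow> 'a set" where
  "sublevel \<alpha> f t = {x. 0 < f x \<and> f x powr \<alpha> - 1 \<le> t}"

text \<open>
  The last fact is where concavity enters: \<open>\<theta>\<close> is convex and \<open>\<theta> 0 = 0\<close>, hence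
  \<open>\<theta> (l x) \<le> l \<theta> x\<close> for \<open>0 \<le> l \<le> 1\<close>. Boundedness comes from the decay of \<open>f\<close> at infinity.
\<close>

lemma
  fixes f :: "'a::euclidean_space \<Rightarrow> real"
  assumes f: "f \<in> C_alpha \<alpha>" and \<alpha>: "\<alpha> < 0"
  shows sublevel_borel: "sublevel \<alpha> f t \<in> sets borel"
    and sublevel_bounded: "bounded (sublevel \<alpha> f t)"
    and sublevel_finite: "emeasure lborel (sublevel \<alpha> f t) < \<infinity>"
    and sublevel_mono: "s \<le> t \<Longrightarrow> sublevel \<alpha> f s \<subseteq> sublevel \<alpha> f t"
    and sublevel_scaleR: "x \<in> sublevel \<alpha> f t \<Longrightarrow> 0 \<le> l \<Longrightarrow> l \<le> 1 \<Longrightarrow> l *\<^sub>R x \<in> sublevel \<alpha> f (l * t)"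
proof -
  note [measurable] = C_alpha_borel[OF f]
  show borel: "sublevel \<alpha> f t \<in> sets borel" unfolding sublevel_def by measurable
  show bdd: "bounded (sublevel \<alpha> f t)"
  proof (cases "1 + t > 0")
    case True
    have "sublevel \<alpha> f t \<subseteq> {x. f x \<ge> (1 + t) powr (1 / \<alpha>)}"
      using \<alpha> True by (auto simp: sublevel_def powr_inverse_le_iff)
    then show ?thesis
      using C_alpha_bounded_superlevel[OF f, of "(1 + t) powr (1 / \<alpha>)"] True bounded_subset by force
  next
    case False
    then have "sublevel \<alpha> f t = {}"
      by (auto simp: sublevel_def) (smt (verit) powr_gt_zero)
    then show ?thesis by simp
  qed
  show "emeasure lborel (sublevel \<alpha> f t) < \<infinity>"
    by (rule emeasure_bounded_finite[OF bdd])
  show "s \<le> t \<Longrightarrow> sublevel \<alpha> f s \<subseteq> sublevel \<alpha> f t" by (auto simp: sublevel_def)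
  assume x: "x \<in> sublevel \<alpha> f t" and l: "0 \<le> l" "l \<le> 1"
  then have fx: "f x > 0" "f x powr \<alpha> \<le> 1 + t" by (auto simp: sublevel_def)
  have ge1: "f x powr \<alpha> \<ge> 1" using one_le_powr_neg fx \<alpha> C_alpha_le_1[OF f] by simp
  define m where "m = l * f x powr \<alpha> + (1 - l)"
  have "l * f x powr \<alpha> \<ge> l * 1" using ge1 l by (intro mult_left_mono) auto
  then have m: "m \<ge> 1" by (simp add: m_def)
  have "m powr (1 / \<alpha>) \<le> f (l *\<^sub>R x)"
    using C_alpha_radial[OF f fx(1) l] \<alpha> by (simp add: alpha_mean_def m_def)
  moreover from this m have pos: "f (l *\<^sub>R x) > 0"
    by (smt (verit) powr_gt_zero)
  ultimately have "f (l *\<^sub>R x) powr \<alpha> \<le> m"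
    using powr_inverse_le_iff[OF \<alpha> pos, of m] m by simp
  also have "m - 1 = l * (f x powr \<alpha> - 1)" by (simp add: m_def algebra_simps)
  then have "m \<le> 1 + l * t" using mult_left_mono[OF fx(2) l(1)] by (simp add: algebra_simps)
  finally show "l *\<^sub>R x \<in> sublevel \<alpha> f (l * t)" using pos by (simp add: sublevel_def)
qed

text \<open>
  The volume of \<open>{\<theta> \<le> t}\<close> grows at most like \<open>t\<^sup>n\<close>, because shrinking this set by the factor
  \<open>s / t\<close> puts it inside \<open>{\<theta> \<le> s}\<close>.
\<close>

lemma measure_sublevel_scale:
  fixes f :: "'a::euclidean_space \<Rightarrow> real"
  assumes f: "f \<in> C_alpha \<alpha>" and \<alpha>: "\<alpha> < 0" and st: "0 \<le> s" "s \<le> t"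
  shows "measure lborel (sublevel \<alpha> f t) * s ^ DIM('a) \<le> measure lborel (sublevel \<alpha> f s) * t ^ DIM('a)"
proof (cases "s = 0")
  case True
  then show ?thesis using st by (simp add: zero_power)
next
  case False
  define l where "l = s / t"
  have l: "0 < l" "l \<le> 1" "l * t = s" using st False by (auto simp: l_def)
  note [measurable] = sublevel_borel[OF f \<alpha>]
  have "ennreal (l ^ DIM('a)) * emeasure lborel (sublevel \<alpha> f t)
      = ennreal (\<bar>l\<bar> ^ DIM('a)) * (\<integral>\<^sup>+x. indicator (sublevel \<alpha> f t) x \<partial>lborel)"
    using l by simp
  also have "\<dots> \<le> ennreal (\<bar>l\<bar> ^ DIM('a)) * (\<integral>\<^sup>+x. indicator (sublevel \<alpha> f s) (l *\<^sub>R x) \<partial>lborel)"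
    using sublevel_scaleR[OF f \<alpha>, of _ t l] l
    by (intro mult_left_mono nn_integral_mono) (auto simp: indicator_def)
  also have "\<dots> = (\<integral>\<^sup>+x. indicator (sublevel \<alpha> f s) x \<partial>lborel)"
    using l by (intro nn_integral_lborel_scaleR[symmetric]) auto
  also have "\<dots> = emeasure lborel (sublevel \<alpha> f s)" by simp
  finally have "l ^ DIM('a) * measure lborel (sublevel \<alpha> f t) \<le> measure lborel (sublevel \<alpha> f s)"
    using sublevel_finite[OF f \<alpha>] l
    by (simp add: emeasure_eq_ennreal_measure less_top[symmetric] flip: ennreal_mult)
  then show ?thesis using st False by (simp add: l_def power_divide field_simps)
qed

text \<open>
  In terms of \<open>\<theta> = a\<^sup>\<alpha> - 1\<close> this is \<open>(1 + c \<theta>)\<^sup>-\<^sup>b\<close>. With \<open>b = - m / \<alpha>\<close>, taking \<open>c = 1\<close> gives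
  \<open>a\<^sup>m\<close>, and taking \<open>m = 2\<close> and \<open>c = 1 / 2\<close> gives the square of the \<open>\<alpha>\<close>-mean of \<open>a\<close> and 1
  with equal weights. At \<open>a = 0\<close>, where \<open>\<theta> = \<infinity>\<close>, the value is 0.
\<close>

definition dilated_power :: "real \<Rightarrow> real \<Rightarrow> real \<Rightarrow> real \<Rightarrow> real" where
  "dilated_power \<alpha> c b a = (if a = 0 then 0 else (1 + c * (a powr \<alpha> - 1)) powr (- b))"

lemma dilated_power_layer_cake:
  fixes f :: "'a::euclidean_space \<Rightarrow> real"
  assumes f: "f \<in> C_alpha \<alpha>" and \<alpha>: "\<alpha> < 0" and b: "b > 0" and c: "c > 0"
  shows "(\<integral>\<^sup>+x. ennreal (dilated_power \<alpha> c b (f x)) \<partial>lborel)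
    = (\<integral>\<^sup>+t. ennreal (measure lborel (sublevel \<alpha> f t) * (b * c * (1 + c * t) powr (- b - 1))) * indicator {0..} t \<partial>lborel)"
proof -
  define w where "w t = b * c * (1 + c * t) powr (- b - 1)" for t
  note [measurable] = C_alpha_borel[OF f]
  have [measurable]: "w \<in> borel_measurable borel" unfolding w_def by measurable
  have w: "w t \<ge> 0" for t using b c by (simp add: w_def)
  let ?J = "\<lambda>x t. if 0 < f x \<and> f x powr \<alpha> - 1 \<le> t \<and> 0 \<le> t then ennreal (w t) else 0"
  have "ennreal (dilated_power \<alpha> c b (f x)) = (\<integral>\<^sup>+t. ?J x t \<partial>lborel)" for x
  proof (cases "f x = 0")
    case True
    then show ?thesis by (simp add: dilated_power_def)
  next
    case False
    then have fx: "f x > 0" using C_alpha_nonneg[OF f, of x] by simp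
    define \<theta> where "\<theta> = f x powr \<alpha> - 1"
    have \<theta>: "\<theta> \<ge> 0" using one_le_powr_neg[of \<alpha> "f x"] fx \<alpha> C_alpha_le_1[OF f] by (simp add: \<theta>_def)
    have "(\<integral>\<^sup>+t. ennreal (w t) * indicator {\<theta>..} t \<partial>lborel) = ennreal (0 - - ((1 + c * \<theta>) powr (- b)))"
    proof (rule nn_integral_FTC_atLeast)
      show "((\<lambda>t. - ((1 + c * t) powr (- b))) \<longlongrightarrow> 0) at_top" using b c by real_asymp
      fix t assume "\<theta> \<le> t"
      then have "1 + c * t > 0" using \<theta> c by (simp add: add_pos_nonneg)
      then show "((\<lambda>t. - ((1 + c * t) powr (- b))) has_real_derivative w t) (at t)"
        unfolding w_def by (auto intro!: derivative_eq_intros)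
    qed (auto simp: w)
    moreover have "(\<integral>\<^sup>+t. ?J x t \<partial>lborel) = (\<integral>\<^sup>+t. ennreal (w t) * indicator {\<theta>..} t \<partial>lborel)"
      using fx \<theta> by (intro nn_integral_cong) (auto simp: \<theta>_def indicator_def)
    ultimately show ?thesis using False by (simp add: dilated_power_def \<theta>_def)
  qed
  then have "(\<integral>\<^sup>+x. ennreal (dilated_power \<alpha> c b (f x)) \<partial>lborel) = (\<integral>\<^sup>+x. (\<integral>\<^sup>+t. ?J x t \<partial>lborel) \<partial>lborel)"
    by simp
  also have "\<dots> = (\<integral>\<^sup>+t. (\<integral>\<^sup>+x. ?J x t \<partial>lborel) \<partial>lborel)"
    by (rule lborel_pair.Fubini'[symmetric]) measurable
  also have "\<dots> = (\<integral>\<^sup>+t. ennreal (measure lborel (sublevel \<alpha> f t) * w t) * indicator {0..} t \<partial>lborel)"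
  proof (rule nn_integral_cong)
    fix t :: real
    have "(\<integral>\<^sup>+x. ?J x t \<partial>lborel) = (\<integral>\<^sup>+x. (ennreal (w t) * indicator {0..} t) * indicator (sublevel \<alpha> f t) x \<partial>lborel)"
      by (intro nn_integral_cong) (auto simp: sublevel_def indicator_def)
    also have "\<dots> = (ennreal (w t) * indicator {0..} t) * emeasure lborel (sublevel \<alpha> f t)"
      using sublevel_borel[OF f \<alpha>] by (intro nn_integral_cmult_indicator) auto
    also have "\<dots> = ennreal (measure lborel (sublevel \<alpha> f t) * w t) * indicator {0..} t"
      using sublevel_finite[OF f \<alpha>, of t] w
      by (simp add: emeasure_eq_ennreal_measure less_top[symmetric] ennreal_mult mult_ac)
    finally show "(\<integral>\<^sup>+x. ?J x t \<partial>lborel) = \<dots>" .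
  qed
  finally show ?thesis unfolding w_def .
qed

text \<open>
  The extremal case is \<open>\<theta>\<close> homogeneous of degree 1, where both sides are Beta integrals; this
  is where the constant comes from. In general, write \<open>b = - 1 / \<alpha> > n\<close>. By the layer-cake
  formula both integrals are integrals of the volumes of \<open>{\<theta> \<le> t}\<close> against
  explicit weights. The constant is the one that makes the \<open>n\<close>-th moments of the weights equal,
  the weights cross once, and the volumes grow at most like \<open>t\<^sup>n\<close>. The bound \<open>c \<ge> 1 / 2\<close> makes
  each factor of the constant exceed 1, so that the weight of the left side is the
  smaller one near 0, as the crossing argument demands.
\<close>

lemma L1_norm_le_dilated_power:
  fixes f :: "'a::euclidean_space \<Rightarrow> real"
  assumes f: "f \<in> C_alpha \<alpha>" and \<alpha>: "- 1 / real DIM('a) < \<alpha>" "\<alpha> < 0" and c: "c \<ge> 1 / 2"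
  shows "L1_norm f \<le> ennreal (c ^ DIM('a) * (\<Prod>j = 1..DIM('a). (2 + real j * \<alpha>) / (1 + real j * \<alpha>)))
    * (\<integral>\<^sup>+x. ennreal (dilated_power \<alpha> c (- 2 / \<alpha>) (f x)) \<partial>lborel)"
proof -
  define n where "n = DIM('a)"
  define b where "b = - 1 / \<alpha>"
  define C where "C = c ^ n * (\<Prod>j = 1..n. (2 + real j * \<alpha>) / (1 + real j * \<alpha>))"
  have n: "n > 0" by (simp add: n_def)
  have b: "b > real n" "b > 0"
    using \<alpha> n by (auto simp: b_def n_def[symmetric] field_simps)
  have C_eq: "C = c ^ n * (\<Prod>j = 1..n. (2 * b - real j) / (b - real j))"
  proof -
    have "(2 + real j * \<alpha>) / (1 + real j * \<alpha>) = (2 * b - real j) / (b - real j)" if "j \<in> {1..n}" for j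
    proof -
      have "2 + real j * \<alpha> = (- \<alpha>) * (2 * b - real j)" "1 + real j * \<alpha> = (- \<alpha>) * (b - real j)"
        using \<alpha> by (auto simp: b_def field_simps)
      then show ?thesis using \<alpha> by simp
    qed
    then show ?thesis unfolding C_def by (metis (no_types, lifting) prod.cong)
  qed
  have "C > 1"
  proof -
    have "C = (\<Prod>j = 1..n. c * ((2 * b - real j) / (b - real j)))"
      unfolding C_eq prod.distrib by simp
    also have "1 < \<dots>"
    proof (rule less_1_prod)
      fix j assume j: "j \<in> {1..n}"
      then have "b - real j > 0" using b by auto
      then have "(2 * b - real j) / (b - real j) > 2" using j by (simp add: field_simps)
      then have "1 / 2 * 2 < c * ((2 * b - real j) / (b - real j))"
        using c by (intro mult_le_less_imp_less) auto
      then show "1 < c * ((2 * b - real j) / (b - real j))" by simp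
    qed (use n in auto)
    finally show ?thesis .
  qed
  moreover have "2 * c * C \<ge> 1 * C" using c \<open>C > 1\<close> by (intro mult_right_mono) auto
  ultimately have C: "C > 0" "2 * c * C > 1" by linarith+
  have c0: "c > 0" using c by linarith
  obtain t\<^sub>0 where t0: "t\<^sub>0 > 0"
    "\<And>t. 0 \<le> t \<Longrightarrow> t \<le> t\<^sub>0 \<Longrightarrow> b * (1 + t) powr (- b - 1) \<le> C * (2 * b * c * (1 + c * t) powr (- 2 * b - 1))"
    "\<And>t. t\<^sub>0 \<le> t \<Longrightarrow> C * (2 * b * c * (1 + c * t) powr (- 2 * b - 1)) \<le> b * (1 + t) powr (- b - 1)"
    using single_crossing_powr[OF b(2) c0 C(2)] by blast
  let ?v = "\<lambda>t. measure lborel (sublevel \<alpha> f t)"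
  let ?w1 = "\<lambda>t. b * (1 + t) powr (- b - 1)"
  let ?w2 = "\<lambda>t. 2 * b * c * (1 + c * t) powr (- 2 * b - 1)"
  have split0: "(\<Prod>j\<le>n. r - real j) = r * (\<Prod>j = 1..n. r - real j)" for r
    by (simp add: atMost_atLeast0 prod.atLeast_Suc_atMost)
  have moment1: "(\<integral>\<^sup>+t. ennreal (t ^ n * ?w1 t) * indicator {0..} t \<partial>lborel)
    = ennreal (fact n / (\<Prod>j = 1..n. b - real j))"
  proof -
    have "(\<integral>\<^sup>+t. ennreal (t ^ n * ?w1 t) * indicator {0..} t \<partial>lborel)
      = (\<integral>\<^sup>+t. ennreal b * (ennreal (t ^ n * (1 + 1 * t) powr (- b - 1)) * indicator {0..} t) \<partial>lborel)"
      using b by (intro nn_integral_cong) (auto simp: indicator_def mult_ac simp flip: ennreal_mult)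
    also have "\<dots> = ennreal b * ennreal (fact n / (1 ^ Suc n * (\<Prod>j\<le>n. b - real j)))"
      by (subst nn_integral_cmult) (use nn_integral_powr_moment[OF b(1), of 1] in auto)
    also have "\<dots> = ennreal (fact n / (\<Prod>j = 1..n. b - real j))"
      unfolding split0 using b by (auto simp flip: ennreal_mult' intro!: arg_cong[of _ _ ennreal])
    finally show ?thesis .
  qed
  have moment2: "(\<integral>\<^sup>+t. ennreal (t ^ n * (C * ?w2 t)) * indicator {0..} t \<partial>lborel)
    = ennreal (fact n / (\<Prod>j = 1..n. b - real j))"
  proof -
    have "(\<integral>\<^sup>+t. ennreal (t ^ n * (C * ?w2 t)) * indicator {0..} t \<partial>lborel)
      = (\<integral>\<^sup>+t. ennreal (C * (2 * b * c)) * (ennreal (t ^ n * (1 + c * t) powr (- (2 * b) - 1)) * indicator {0..} t) \<partial>lborel)"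
      using b c0 C by (intro nn_integral_cong) (auto simp: indicator_def mult_ac simp flip: ennreal_mult)
    also have "\<dots> = ennreal (C * (2 * b * c)) * ennreal (fact n / (c ^ Suc n * (\<Prod>j\<le>n. 2 * b - real j)))"
      by (subst nn_integral_cmult) (use nn_integral_powr_moment[of n "2 * b" c] b c0 in auto)
    also have "\<dots> = ennreal (C * (2 * b * c) * (fact n / (c ^ Suc n * (\<Prod>j\<le>n. 2 * b - real j))))"
      using b c0 C by (subst ennreal_mult') auto
    also have "C * (2 * b * c) * (fact n / (c ^ Suc n * (\<Prod>j\<le>n. 2 * b - real j)))
        = fact n / (\<Prod>j = 1..n. b - real j)"
    proof -
      have "(\<Prod>j = 1..n. 2 * b - real j) > 0" using b by (intro prod_pos) auto
      then show ?thesis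
        unfolding split0 C_eq prod_dividef using b c0 by (simp add: field_simps)
    qed
    finally show ?thesis .
  qed
  have [measurable]: "?v \<in> borel_measurable borel"
  proof (rule borel_measurable_mono, rule monoI)
    fix s t :: real assume "s \<le> t"
    then show "?v s \<le> ?v t"
      using sublevel_mono[OF f \<alpha>(2)] sublevel_borel[OF f \<alpha>(2)] sublevel_finite[OF f \<alpha>(2)]
      by (intro measure_mono_fmeasurable) (auto simp: fmeasurable_def)
  qed
  have "L1_norm f = (\<integral>\<^sup>+x. ennreal (dilated_power \<alpha> 1 b (f x)) \<partial>lborel)"
    unfolding L1_norm_def
  proof (rule nn_integral_cong)
    fix x
    show "ennreal \<bar>f x\<bar> = ennreal (dilated_power \<alpha> 1 b (f x))"
      using C_alpha_nonneg[OF f, of x] \<alpha> by (auto simp: dilated_power_def b_def powr_powr)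
  qed
  also have "\<dots> = (\<integral>\<^sup>+t. ennreal (?v t * ?w1 t) * indicator {0..} t \<partial>lborel)"
    using dilated_power_layer_cake[OF f \<alpha>(2) b(2), of 1] by simp
  also have "\<dots> \<le> (\<integral>\<^sup>+t. ennreal (?v t * (C * ?w2 t)) * indicator {0..} t \<partial>lborel)"
  proof (rule nn_integral_le_of_single_crossing[where n = n and t\<^sub>0 = t\<^sub>0])
    show "?v t * s ^ n \<le> ?v s * t ^ n" if "0 \<le> s" "s \<le> t" for s t
      using measure_sublevel_scale[OF f \<alpha>(2) that] by (simp add: n_def)
  qed (use b c0 C t0 moment1 moment2 in auto)
  also have "\<dots> = (\<integral>\<^sup>+t. ennreal C * (ennreal (?v t * ((2 * b) * c * (1 + c * t) powr (- (2 * b) - 1))) * indicator {0..} t) \<partial>lborel)"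
    using b c0 C by (intro nn_integral_cong) (auto simp: indicator_def mult_ac simp flip: ennreal_mult)
  also have "\<dots> = ennreal C * (\<integral>\<^sup>+t. ennreal (?v t * ((2 * b) * c * (1 + c * t) powr (- (2 * b) - 1))) * indicator {0..} t \<partial>lborel)"
    by (intro nn_integral_cmult) measurable
  also have "\<dots> = ennreal C * (\<integral>\<^sup>+x. ennreal (dilated_power \<alpha> c (2 * b) (f x)) \<partial>lborel)"
    using dilated_power_layer_cake[OF f \<alpha>(2) _ c0, of "2 * b"] b by simp
  finally show ?thesis by (simp add: C_def n_def b_def)
qed

section \<open>Alpha-sums stay in the class\<close>

lemma
  assumes "\<alpha> \<le> 0" "0 \<le> a" "a \<le> 1" "0 \<le> b" "b \<le> 1"
  shows alpha_prod_nonneg: "0 \<le> alpha_prod \<alpha> a b"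
    and alpha_prod_le_left: "alpha_prod \<alpha> a b \<le> a"
    and alpha_prod_le_right: "alpha_prod \<alpha> a b \<le> b"
proof -
  show "0 \<le> alpha_prod \<alpha> a b" using assms by (auto simp: alpha_prod_def)
  have le: "alpha_prod \<alpha> a b \<le> a" if "0 \<le> a" "a \<le> 1" "0 \<le> b" "b \<le> 1" for a b
  proof (cases "\<alpha> = 0 \<or> a = 0 \<or> b = 0")
    case True
    then show ?thesis using that by (auto simp: alpha_prod_def mult_left_le)
  next
    case False
    then have *: "\<alpha> < 0" "a > 0" "b > 0" using assms(1) that by auto
    have "b powr \<alpha> \<ge> 1" "a powr \<alpha> \<ge> 1" using * that by (auto intro: one_le_powr_neg)
    then have "(a powr \<alpha> + b powr \<alpha> - 1) powr (1 / \<alpha>) \<le> a"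
      using powr_inverse_le_iff[of \<alpha> a "a powr \<alpha> + b powr \<alpha> - 1"] * by simp
    then show ?thesis using False by (simp add: alpha_prod_def)
  qed
  show "alpha_prod \<alpha> a b \<le> a" using le assms by simp
  have "alpha_prod \<alpha> a b = alpha_prod \<alpha> b a" by (auto simp: alpha_prod_def algebra_simps)
  then show "alpha_prod \<alpha> a b \<le> b" using le[of b a] assms by simp
qed

lemma
  assumes "\<alpha> < 0" "0 < a" "a \<le> 1" "0 < b" "b \<le> 1"
  shows alpha_prod_pos: "0 < alpha_prod \<alpha> a b"
    and alpha_prod_powr: "alpha_prod \<alpha> a b powr \<alpha> = a powr \<alpha> + b powr \<alpha> - 1"
proof -
  have "a powr \<alpha> \<ge> 1" "b powr \<alpha> \<ge> 1" using assms by (auto intro!: one_le_powr_neg)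
  then have "a powr \<alpha> + b powr \<alpha> - 1 > 0" by linarith
  then show "0 < alpha_prod \<alpha> a b" "alpha_prod \<alpha> a b powr \<alpha> = a powr \<alpha> + b powr \<alpha> - 1"
    using assms by (auto simp: alpha_prod_def powr_powr)
qed

lemma alpha_prod_mono:
  assumes "\<alpha> \<le> 0" "0 \<le> a" "a \<le> a'" "a' \<le> 1" "0 \<le> b" "b \<le> b'" "b' \<le> 1"
  shows "alpha_prod \<alpha> a b \<le> alpha_prod \<alpha> a' b'"
proof (cases "\<alpha> = 0 \<or> a = 0 \<or> b = 0")
  case True
  then consider "\<alpha> = 0" | "alpha_prod \<alpha> a b = 0" by (auto simp: alpha_prod_def)
  then show ?thesis
  proof cases
    case 1
    then show ?thesis using assms by (auto simp: alpha_prod_def intro!: mult_mono)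
  next
    case 2
    then show ?thesis using alpha_prod_nonneg[of \<alpha> a' b'] assms by simp
  qed
next
  case False
  then have *: "\<alpha> < 0" "0 < a" "0 < b" "0 < a'" "0 < b'" using assms by auto
  have "a' powr \<alpha> \<le> a powr \<alpha>" "b' powr \<alpha> \<le> b powr \<alpha>"
    using * assms by (auto intro!: powr_mono2')
  moreover have "a' powr \<alpha> \<ge> 1" "b' powr \<alpha> \<ge> 1" using * assms by (auto intro!: one_le_powr_neg)
  ultimately show ?thesis using False *
    by (auto simp: alpha_prod_def intro!: powr_mono2')
qed

lemma alpha_prod_tendsto:
  assumes "\<alpha> \<le> 0" "a \<longlonglongrightarrow> A" "b \<longlonglongrightarrow> B" "0 < A" "A \<le> 1" "0 < B" "B \<le> 1"
  shows "(\<lambda>n. alpha_prod \<alpha> (a n) (b n)) \<longlonglongrightarrow> alpha_prod \<alpha> A B"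
proof (cases "\<alpha> = 0")
  case True
  then show ?thesis using assms by (auto simp: alpha_prod_def intro!: tendsto_mult)
next
  case False
  have "A powr \<alpha> \<ge> 1" "B powr \<alpha> \<ge> 1" using assms by (auto intro!: one_le_powr_neg)
  then have "(\<lambda>n. (a n powr \<alpha> + b n powr \<alpha> - 1) powr (1 / \<alpha>)) \<longlonglongrightarrow> (A powr \<alpha> + B powr \<alpha> - 1) powr (1 / \<alpha>)"
    using assms by (intro tendsto_intros) auto
  moreover have "\<forall>\<^sub>F n in sequentially. a n > 0" "\<forall>\<^sub>F n in sequentially. b n > 0"
    using order_tendstoD(1)[OF assms(2,4)] order_tendstoD(1)[OF assms(3,6)] by auto
  then have "\<forall>\<^sub>F n in sequentially. (a n powr \<alpha> + b n powr \<alpha> - 1) powr (1 / \<alpha>) = alpha_prod \<alpha> (a n) (b n)"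
    by eventually_elim (use False in \<open>auto simp: alpha_prod_def\<close>)
  ultimately show ?thesis
    using assms False by (auto simp: alpha_prod_def elim: Lim_transform_eventually)
qed

lemma upper_semicontinuous_sequentially:
  assumes "upper_semicontinuous f" "y \<longlonglongrightarrow> y'" "(\<lambda>n. f (y n)) \<longlonglongrightarrow> a"
  shows "a \<le> f y'"
proof (rule ccontr)
  assume "\<not> a \<le> f y'"
  then obtain c where c: "f y' < c" "c < a" using dense by (auto simp: not_le)
  then have "\<forall>\<^sub>F z in nhds y'. f z < c" using assms(1) by (auto simp: upper_semicontinuous_def)
  then have "\<forall>\<^sub>F n in sequentially. f (y n) < c" using assms(2) by (rule eventually_compose_filterlim)
  moreover have "\<forall>\<^sub>F n in sequentially. f (y n) > c" using order_tendstoD(1)[OF assms(3) c(2)] .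
  ultimately have "\<forall>\<^sub>F n in sequentially. False" by eventually_elim auto
  then show False by simp
qed

context
  fixes \<alpha> :: real and g h :: "'a::euclidean_space \<Rightarrow> real"
  assumes \<alpha>: "\<alpha> \<le> 0" and g: "g \<in> C_alpha \<alpha>" and h: "h \<in> C_alpha \<alpha>"
begin

text \<open>
  Compactness behind both the attainment of the supremum and the closedness of its
  superlevel sets. A lower bound \<open>\<delta>\<close> on the products bounds both factors below, so the points
  stay in bounded superlevel sets of \<open>g\<close> and \<open>h\<close>. Extracting limits of the values \<open>g (y n)\<close> and
  \<open>h (z n)\<close> together with the points reduces upper semicontinuity of the
  product to continuity and monotonicity of \<open>alpha_prod\<close>.
\<close>

lemma alpha_prod_values_limit:
  assumes x: "x \<longlonglongrightarrow> x'" and s: "s \<longlonglongrightarrow> s'" "\<And>n. \<delta> \<le> s n" and "\<delta> > 0"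
    and yz: "\<And>n. y n + z n = x n" "\<And>n. s n \<le> alpha_prod \<alpha> (g (y n)) (h (z n))"
  shows "\<exists>y' z'. y' + z' = x' \<and> s' \<le> alpha_prod \<alpha> (g y') (h z')"
proof -
  note 01 = C_alpha_nonneg[OF g] C_alpha_nonneg[OF h] C_alpha_le_1[OF g] C_alpha_le_1[OF h]
  have lower: "\<delta> \<le> g (y n)" "\<delta> \<le> h (z n)" for n
    using s(2)[of n] yz(2)[of n] alpha_prod_le_left[OF \<alpha>, of "g (y n)" "h (z n)"]
      alpha_prod_le_right[OF \<alpha>, of "g (y n)" "h (z n)"] 01 by (force intro: order_trans)+
  let ?u = "\<lambda>n. (y n, z n, g (y n), h (z n))"
  have "bounded ({x. g x \<ge> \<delta>} \<times> {x. h x \<ge> \<delta>} \<times> {0..1::real} \<times> {0..1::real})"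
    using C_alpha_bounded_superlevel[OF g \<open>\<delta> > 0\<close>] C_alpha_bounded_superlevel[OF h \<open>\<delta> > 0\<close>]
    by (intro bounded_Times) auto
  then have "bounded (range ?u)" by (rule bounded_subset) (use lower 01 in auto)
  from bounded_imp_convergent_subsequence[OF this] obtain l r where
    r: "strict_mono (r :: nat \<Rightarrow> nat)" and lim: "(?u \<circ> r) \<longlonglongrightarrow> l" by blast
  obtain y' z' a b where l: "l = (y', z', a, b)" by (metis prod.exhaust)
  have y': "(\<lambda>n. y (r n)) \<longlonglongrightarrow> y'" using tendsto_fst[OF lim] by (simp add: l o_def)
  have z': "(\<lambda>n. z (r n)) \<longlonglongrightarrow> z'" using tendsto_fst[OF tendsto_snd[OF lim]] by (simp add: l o_def)
  have a: "(\<lambda>n. g (y (r n))) \<longlonglongrightarrow> a"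
    using tendsto_fst[OF tendsto_snd[OF tendsto_snd[OF lim]]] by (simp add: l o_def)
  have b: "(\<lambda>n. h (z (r n))) \<longlonglongrightarrow> b"
    using tendsto_snd[OF tendsto_snd[OF tendsto_snd[OF lim]]] by (simp add: l o_def)
  have "a \<ge> \<delta>" "b \<ge> \<delta>" using lower by (auto intro: LIMSEQ_le_const[OF a] LIMSEQ_le_const[OF b])
  moreover have ab: "a \<le> g y'" "b \<le> h z'"
    using upper_semicontinuous_sequentially[OF C_alpha_usc[OF g] y' a]
      upper_semicontinuous_sequentially[OF C_alpha_usc[OF h] z' b] by auto
  ultimately have ab01: "0 < a" "a \<le> 1" "0 < b" "b \<le> 1" using \<open>\<delta> > 0\<close> 01 by (auto intro: order_trans)
  have "s' \<le> alpha_prod \<alpha> a b"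
    by (rule LIMSEQ_le[OF LIMSEQ_subseq_LIMSEQ[OF s(1) r] alpha_prod_tendsto[OF \<alpha> a b ab01]])
      (auto simp: yz(2))
  also have "\<dots> \<le> alpha_prod \<alpha> (g y') (h z')" using ab ab01 01 by (intro alpha_prod_mono[OF \<alpha>]) auto
  finally have "s' \<le> alpha_prod \<alpha> (g y') (h z')" .
  moreover have "y' + z' = x'"
    using LIMSEQ_unique[OF tendsto_add[OF y' z']] LIMSEQ_subseq_LIMSEQ[OF x r] yz(1) by (simp add: o_def)
  ultimately show ?thesis by blast
qed

lemma alpha_prod_le_alpha_sum: "alpha_prod \<alpha> (g y) (h z) \<le> alpha_sum \<alpha> g h (y + z)"
proof -
  have "alpha_prod \<alpha> (g y) (h z) \<le> 1" for y z
    using alpha_prod_le_left[OF \<alpha>, of "g y" "h z"] C_alpha_nonneg[OF g, of y] C_alpha_nonneg[OF h, of z]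
      C_alpha_le_1[OF g, of y] C_alpha_le_1[OF h, of z] by simp
  then show ?thesis unfolding alpha_sum_def by (intro cSup_upper bdd_aboveI[of _ 1]) auto
qed

lemma alpha_sum_attained: "\<exists>y z. y + z = x \<and> alpha_sum \<alpha> g h x = alpha_prod \<alpha> (g y) (h z)"
proof -
  let ?T = "alpha_sum \<alpha> g h x"
  have nonneg: "0 \<le> alpha_prod \<alpha> (g y) (h z)" for y z
    using alpha_prod_nonneg[OF \<alpha>] C_alpha_nonneg[OF g] C_alpha_nonneg[OF h] C_alpha_le_1[OF g] C_alpha_le_1[OF h]
    by blast
  have "\<exists>y z. y + z = x \<and> ?T \<le> alpha_prod \<alpha> (g y) (h z)"
  proof (cases "?T \<le> 0")
    case True
    then show ?thesis using nonneg[of 0 x] by (intro exI[of _ 0] exI[of _ x]) auto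
  next
    case False
    \<comment> \<open>Near-maximisers at levels increasing to the supremum, all at least half of it.\<close>
    define s where "s n = ?T * (1 - 1 / real (n + 2))" for n
    have s_less: "s n < ?T" for n using False by (simp add: s_def field_simps)
    have "\<exists>y z. y + z = x \<and> s n \<le> alpha_prod \<alpha> (g y) (h z)" for n
    proof -
      have "{alpha_prod \<alpha> (g y) (h z) | y z. y + z = x} \<noteq> {}"
        using add_0[of x] by blast
      from less_cSupD[OF this s_less[of n, unfolded alpha_sum_def]] show ?thesis by force
    qed
    then obtain y z where "\<And>n. y n + z n = x" "\<And>n. s n \<le> alpha_prod \<alpha> (g (y n)) (h (z n))" by metis
    moreover have "s \<longlonglongrightarrow> ?T"
    proof -
      have "(\<lambda>n. c * (1 - 1 / real (n + 2))) \<longlonglongrightarrow> c" for c :: real by real_asymp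
      then show ?thesis unfolding s_def .
    qed
    moreover have "?T / 2 \<le> s n" for n using False by (simp add: s_def field_simps)
    ultimately show ?thesis using False alpha_prod_values_limit[of "\<lambda>_. x" x s ?T "?T / 2" y z] by auto
  qed
  then show ?thesis using alpha_prod_le_alpha_sum by (metis order_antisym)
qed

lemma alpha_sum_nonneg: "0 \<le> alpha_sum \<alpha> g h x"
  and alpha_sum_le_1: "alpha_sum \<alpha> g h x \<le> 1"
proof -
  obtain y z where *: "alpha_sum \<alpha> g h x = alpha_prod \<alpha> (g y) (h z)" using alpha_sum_attained by blast
  note 01 = C_alpha_nonneg[OF g, of y] C_alpha_nonneg[OF h, of z] C_alpha_le_1[OF g, of y] C_alpha_le_1[OF h, of z]
  show "0 \<le> alpha_sum \<alpha> g h x" using alpha_prod_nonneg[OF \<alpha>] 01 * by simp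
  show "alpha_sum \<alpha> g h x \<le> 1" using alpha_prod_le_left[OF \<alpha>, of "g y" "h z"] 01 * by simp
qed

lemma upper_semicontinuous_alpha_sum: "upper_semicontinuous (alpha_sum \<alpha> g h)"
  unfolding upper_semicontinuous_def
proof (intro allI impI)
  fix x c assume less: "alpha_sum \<alpha> g h x < c"
  then have c: "c > 0" using alpha_sum_nonneg[of x] by simp
  have "closed {x. c \<le> alpha_sum \<alpha> g h x}"
    unfolding closed_sequential_limits
  proof (intro allI impI, elim conjE)
    fix X x' assume X: "\<forall>n. X n \<in> {x. c \<le> alpha_sum \<alpha> g h x}" "X \<longlonglongrightarrow> x'"
    have "\<forall>n. \<exists>y z. y + z = X n \<and> alpha_sum \<alpha> g h (X n) = alpha_prod \<alpha> (g y) (h z)"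
      using alpha_sum_attained by blast
    then obtain y z where "\<And>n. y n + z n = X n" "\<And>n. alpha_sum \<alpha> g h (X n) = alpha_prod \<alpha> (g (y n)) (h (z n))"
      by metis
    then have "\<exists>y' z'. y' + z' = x' \<and> c \<le> alpha_prod \<alpha> (g y') (h z')"
      using X c by (intro alpha_prod_values_limit[of X x' "\<lambda>_. c" c c y z]) auto
    then show "x' \<in> {x. c \<le> alpha_sum \<alpha> g h x}" using alpha_prod_le_alpha_sum by (force intro: order_trans)
  qed
  then have "open {x. alpha_sum \<alpha> g h x < c}" by (simp add: closed_def Compl_eq not_le)
  then show "\<forall>\<^sub>F y in nhds x. alpha_sum \<alpha> g h y < c" using less eventually_nhds by blast
qed

lemma alpha_sum_tendsto_0: "(alpha_sum \<alpha> g h \<longlongrightarrow> 0) at_infinity"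
proof (rule tendstoI)
  fix e :: real assume e: "e > 0"
  obtain R where R: "\<And>x. g x \<ge> e \<Longrightarrow> norm x \<le> R"
    using C_alpha_bounded_superlevel[OF g e] by (auto simp: bounded_iff)
  obtain S where S: "\<And>x. h x \<ge> e \<Longrightarrow> norm x \<le> S"
    using C_alpha_bounded_superlevel[OF h e] by (auto simp: bounded_iff)
  have "alpha_sum \<alpha> g h x < e" if "norm x \<ge> R + S + 1" for x
  proof (rule ccontr)
    assume "\<not> ?thesis"
    obtain y z where yz: "y + z = x" "alpha_sum \<alpha> g h x = alpha_prod \<alpha> (g y) (h z)"
      using alpha_sum_attained by blast
    note 01 = C_alpha_nonneg[OF g, of y] C_alpha_nonneg[OF h, of z] C_alpha_le_1[OF g, of y] C_alpha_le_1[OF h, of z]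
    have "g y \<ge> e" "h z \<ge> e"
      using alpha_prod_le_left[OF \<alpha>, of "g y" "h z"] alpha_prod_le_right[OF \<alpha>, of "g y" "h z"] 01 yz \<open>\<not> _\<close> by auto
    from R[OF this(1)] S[OF this(2)] show False
      using norm_triangle_ineq[of y z] yz(1) that by simp
  qed
  then show "\<forall>\<^sub>F x in at_infinity. dist (alpha_sum \<alpha> g h x) 0 < e"
    unfolding eventually_at_infinity using alpha_sum_nonneg by (intro exI[of _ "R + S + 1"]) auto
qed

end

lemma alpha_mean_pos:
  assumes "0 < a" "0 < b" "0 \<le> l" "l \<le> 1"
  shows "0 < alpha_mean \<alpha> l a b"
proof -
  have "l * a powr \<alpha> + (1 - l) * b powr \<alpha> > 0"
    using assms by (cases "l = 0") (auto intro!: add_pos_nonneg)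
  then show ?thesis using assms by (simp add: alpha_mean_def)
qed

text \<open>
  For \<open>\<alpha> < 0\<close>, in the variable \<open>a\<^sup>\<alpha>\<close> the mean is a convex combination and the product is the affine map
  \<open>A + B - 1\<close>, so the two operations commute. This makes the \<open>\<alpha>\<close>-sum of \<open>\<alpha>\<close>-concave
  functions \<open>\<alpha>\<close>-concave.
\<close>

lemma alpha_prod_alpha_mean:
  assumes "\<alpha> \<le> 0" "0 < a" "a \<le> 1" "0 < a'" "a' \<le> 1" "0 < b" "b \<le> 1" "0 < b'" "b' \<le> 1" "0 \<le> l" "l \<le> 1"
  shows "alpha_prod \<alpha> (alpha_mean \<alpha> l a a') (alpha_mean \<alpha> l b b')
    = alpha_mean \<alpha> l (alpha_prod \<alpha> a b) (alpha_prod \<alpha> a' b')"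
proof (cases "\<alpha> = 0")
  case True
  then show ?thesis using assms by (simp add: alpha_prod_def alpha_mean_def powr_mult)
next
  case False
  then have neg: "\<alpha> < 0" using assms by simp
  have M: "alpha_mean \<alpha> l a b powr \<alpha> = l * a powr \<alpha> + (1 - l) * b powr \<alpha>" if "0 < a" "0 < b" for a b
    using that assms(10,11) False by (auto simp: alpha_mean_def powr_powr intro!: add_nonneg_nonneg)
  have pos: "alpha_mean \<alpha> l a a' \<noteq> 0" "alpha_mean \<alpha> l b b' \<noteq> 0"
    using alpha_mean_pos[of a a' l \<alpha>] alpha_mean_pos[of b b' l \<alpha>] assms by auto
  have "l * a powr \<alpha> + (1 - l) * a' powr \<alpha> + (l * b powr \<alpha> + (1 - l) * b' powr \<alpha>) - 1
      = l * (a powr \<alpha> + b powr \<alpha> - 1) + (1 - l) * (a' powr \<alpha> + b' powr \<alpha> - 1)"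
    by (simp add: algebra_simps)
  then show ?thesis
    using pos False assms alpha_prod_powr[OF neg, of a b] alpha_prod_powr[OF neg, of a' b']
    by (simp add: alpha_prod_def[of \<alpha> "alpha_mean \<alpha> l a a'"] M)
      (simp add: alpha_mean_def)
qed

lemma alpha_concave_alpha_sum:
  fixes g h :: "'a::euclidean_space \<Rightarrow> real"
  assumes \<alpha>: "\<alpha> \<le> 0" and g: "g \<in> C_alpha \<alpha>" and h: "h \<in> C_alpha \<alpha>"
  shows "alpha_concave \<alpha> (alpha_sum \<alpha> g h)"
  unfolding alpha_concave_def
proof (intro allI impI ballI)
  fix x x' and l :: real
  assume pos: "0 < alpha_sum \<alpha> g h x" "0 < alpha_sum \<alpha> g h x'" and "l \<in> {0..1}"
  then have l: "0 \<le> l" "l \<le> 1" by auto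
  note 01 = C_alpha_nonneg[OF g] C_alpha_nonneg[OF h] C_alpha_le_1[OF g] C_alpha_le_1[OF h]
  obtain y z where yz: "y + z = x" "alpha_sum \<alpha> g h x = alpha_prod \<alpha> (g y) (h z)"
    using alpha_sum_attained[OF \<alpha> g h] by blast
  obtain y' z' where yz': "y' + z' = x'" "alpha_sum \<alpha> g h x' = alpha_prod \<alpha> (g y') (h z')"
    using alpha_sum_attained[OF \<alpha> g h] by blast
  have gh: "0 < g y" "0 < h z" "0 < g y'" "0 < h z'"
    using pos yz(2) yz'(2) alpha_prod_le_left[OF \<alpha> 01(1,3) 01(2,4)] alpha_prod_le_right[OF \<alpha> 01(1,3) 01(2,4)]
    by (metis less_le_trans)+
  have "alpha_mean \<alpha> l (alpha_sum \<alpha> g h x) (alpha_sum \<alpha> g h x')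
      = alpha_prod \<alpha> (alpha_mean \<alpha> l (g y) (g y')) (alpha_mean \<alpha> l (h z) (h z'))"
    unfolding yz(2) yz'(2) using \<alpha> gh 01 l by (intro alpha_prod_alpha_mean[symmetric]) auto
  also have "\<dots> \<le> alpha_prod \<alpha> (g (l *\<^sub>R y + (1 - l) *\<^sub>R y')) (h (l *\<^sub>R z + (1 - l) *\<^sub>R z'))"
    using C_alpha_concave[OF g] C_alpha_concave[OF h] gh 01 l
    by (intro alpha_prod_mono \<alpha>) (auto simp: alpha_concave_def intro!: less_imp_le[OF alpha_mean_pos])
  also have "\<dots> \<le> alpha_sum \<alpha> g h ((l *\<^sub>R y + (1 - l) *\<^sub>R y') + (l *\<^sub>R z + (1 - l) *\<^sub>R z'))"
    by (rule alpha_prod_le_alpha_sum[OF \<alpha> g h])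
  also have "(l *\<^sub>R y + (1 - l) *\<^sub>R y') + (l *\<^sub>R z + (1 - l) *\<^sub>R z') = l *\<^sub>R x + (1 - l) *\<^sub>R x'"
    by (simp add: yz(1)[symmetric] yz'(1)[symmetric] algebra_simps)
  finally show "alpha_mean \<alpha> l (alpha_sum \<alpha> g h x) (alpha_sum \<alpha> g h x') \<le> alpha_sum \<alpha> g h (l *\<^sub>R x + (1 - l) *\<^sub>R x')" .
qed

lemma sup_norm_eq_1:
  assumes "\<And>x. 0 \<le> f x" "\<And>x. f x \<le> 1" "f 0 = 1"
  shows "sup_norm f = 1"
  unfolding sup_norm_def
proof (rule antisym)
  show "(SUP x. ennreal \<bar>f x\<bar>) \<le> 1" using assms by (intro SUP_least) simp
  have "ennreal \<bar>f 0\<bar> \<le> (SUP x. ennreal \<bar>f x\<bar>)" by (rule SUP_upper) simp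
  then show "1 \<le> (SUP x. ennreal \<bar>f x\<bar>)" using assms(3) by simp
qed

text \<open>
  Closure of the class makes the integral comparison for a single function available for
  \<open>\<alpha>\<close>-sums as well.
\<close>

theorem alpha_sum_C_alpha:
  fixes g h :: "'a::euclidean_space \<Rightarrow> real"
  assumes \<alpha>: "\<alpha> \<le> 0" and g: "g \<in> C_alpha \<alpha>" and h: "h \<in> C_alpha \<alpha>"
  shows "alpha_sum \<alpha> g h \<in> C_alpha \<alpha>"
proof -
  have 0: "alpha_sum \<alpha> g h 0 = 1"
  proof (rule antisym)
    show "1 \<le> alpha_sum \<alpha> g h 0"
      using alpha_prod_le_alpha_sum[OF \<alpha> g h, of 0 0]
      by (simp add: C_alpha_at_0[OF g] C_alpha_at_0[OF h] alpha_prod_def split: if_splits)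
  qed (rule alpha_sum_le_1[OF \<alpha> g h])
  then show ?thesis
    unfolding C_alpha_def mem_Collect_eq
    using alpha_sum_nonneg[OF \<alpha> g h] alpha_sum_le_1[OF \<alpha> g h] upper_semicontinuous_alpha_sum[OF \<alpha> g h]
      alpha_concave_alpha_sum[OF \<alpha> g h] alpha_sum_tendsto_0[OF \<alpha> g h]
    by (auto intro!: sup_norm_eq_1)
qed

lemma reflect_C_alpha:
  fixes f :: "'a::euclidean_space \<Rightarrow> real"
  assumes f: "f \<in> C_alpha \<alpha>"
  shows "reflect f \<in> C_alpha \<alpha>"
proof -
  have "upper_semicontinuous (reflect f)"
    unfolding upper_semicontinuous_def reflect_def
  proof (intro allI impI)
    fix x c assume "f (- x) < c"
    then have "\<forall>\<^sub>F y in nhds (- x). f y < c" using C_alpha_usc[OF f] by (simp add: upper_semicontinuous_def)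
    moreover have "filterlim uminus (nhds (- x)) (nhds x)" by (intro tendsto_minus filterlim_ident)
    ultimately show "\<forall>\<^sub>F y in nhds x. f (- y) < c" by (rule eventually_compose_filterlim)
  qed
  moreover have "alpha_concave \<alpha> (reflect f)"
    unfolding alpha_concave_def reflect_def
  proof (intro allI impI ballI)
    fix x y l assume "0 < f (- x)" "0 < f (- y)" "l \<in> {0..1::real}"
    then have "alpha_mean \<alpha> l (f (- x)) (f (- y)) \<le> f (l *\<^sub>R (- x) + (1 - l) *\<^sub>R (- y))"
      using C_alpha_concave[OF f] unfolding alpha_concave_def by blast
    also have "l *\<^sub>R (- x) + (1 - l) *\<^sub>R (- y) = - (l *\<^sub>R x + (1 - l) *\<^sub>R y)" by (simp add: algebra_simps)
    finally show "alpha_mean \<alpha> l (f (- x)) (f (- y)) \<le> f (- (l *\<^sub>R x + (1 - l) *\<^sub>R y))" .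
  qed
  moreover have "(reflect f \<longlongrightarrow> 0) at_infinity"
  proof -
    have "filterlim uminus at_infinity (at_infinity :: 'a filter)"
      unfolding filterlim_at_infinity[OF order_refl] eventually_at_infinity by auto
    from filterlim_compose[OF C_alpha_tendsto[OF f] this] show ?thesis unfolding reflect_def[abs_def] .
  qed
  ultimately show ?thesis
    unfolding C_alpha_def mem_Collect_eq
    using C_alpha_nonneg[OF f] C_alpha_le_1[OF f] C_alpha_at_0[OF f]
    by (auto simp: reflect_def intro!: sup_norm_eq_1)
qed

section \<open>The triangle inequality\<close>

lemma nn_integral_lborel_translate:
  fixes f :: "'a::euclidean_space \<Rightarrow> ennreal"
  assumes [measurable]: "f \<in> borel_measurable borel"
  shows "(\<integral>\<^sup>+x. f (c + x) \<partial>lborel) = (\<integral>\<^sup>+x. f x \<partial>lborel)"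
proof -
  have "(\<integral>\<^sup>+x. f x \<partial>lborel) = (\<integral>\<^sup>+x. f x \<partial>distr lborel borel ((+) c))"
    by (simp add: lborel_distr_plus)
  also have "\<dots> = (\<integral>\<^sup>+x. f (c + x) \<partial>lborel)" by (rule nn_integral_distr) auto
  finally show ?thesis by simp
qed

text \<open>
  A functional form of Ruzsa's argument for \<open>|A| |B - C| \<le> |A - B| |A - C|\<close>. For fixed \<open>x\<close>
  choose \<open>b - c = x\<close> attaining the \<open>\<alpha>\<close>-sum of \<open>g\<close> and the reflection of \<open>h\<close> at \<open>x\<close>. The pair
  \<open>(a - b, a - c)\<close> has difference \<open>x\<close>, so translating by \<open>b\<close> bounds the integral over
  \<open>a\<close> by the integral over \<open>u\<close> of the product of the two right-hand \<open>\<alpha>\<close>-sums at \<open>u\<close> and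
  \<open>u + x\<close>. Since \<open>x\<close> is fixed meanwhile, \<open>b\<close> and \<open>c\<close> may depend on it non-measurably. Integrating
  over \<open>x\<close> splits the right side by Tonelli's theorem.
\<close>

lemma alpha_sum_triangle:
  fixes f g h :: "'a::euclidean_space \<Rightarrow> real" and G :: "real \<Rightarrow> real"
  assumes \<alpha>: "\<alpha> \<le> 0" and f: "f \<in> C_alpha \<alpha>" and g: "g \<in> C_alpha \<alpha>" and h: "h \<in> C_alpha \<alpha>"
    and [measurable]: "G \<in> borel_measurable borel"
    and G: "\<And>p q r. \<lbrakk>0 \<le> p; p \<le> 1; 0 \<le> q; q \<le> 1; 0 \<le> r; r \<le> 1\<rbrakk>
      \<Longrightarrow> p\<^sup>2 * G (alpha_prod \<alpha> q r) \<le> alpha_prod \<alpha> p q * alpha_prod \<alpha> p r"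
  shows "(\<integral>\<^sup>+x. ennreal ((f x)\<^sup>2) \<partial>lborel) * (\<integral>\<^sup>+x. ennreal (G (alpha_sum \<alpha> g (reflect h) x)) \<partial>lborel)
    \<le> L1_norm (alpha_sum \<alpha> f (reflect g)) * L1_norm (alpha_sum \<alpha> f (reflect h))"
proof -
  let ?F = "alpha_sum \<alpha> f (reflect g)" and ?H = "alpha_sum \<alpha> f (reflect h)"
    and ?T = "alpha_sum \<alpha> g (reflect h)"
  note rg = reflect_C_alpha[OF g] and rh = reflect_C_alpha[OF h]
  note [measurable] = C_alpha_borel[OF f] C_alpha_borel[OF alpha_sum_C_alpha[OF \<alpha> f rg]]
    C_alpha_borel[OF alpha_sum_C_alpha[OF \<alpha> f rh]] C_alpha_borel[OF alpha_sum_C_alpha[OF \<alpha> g rh]]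
  note F0 = alpha_sum_nonneg[OF \<alpha> f rg] and H0 = alpha_sum_nonneg[OF \<alpha> f rh]
  have fibre: "(\<integral>\<^sup>+a. ennreal ((f a)\<^sup>2) \<partial>lborel) * ennreal (G (?T x)) \<le> (\<integral>\<^sup>+u. ennreal (?F u) * ennreal (?H (u + x)) \<partial>lborel)" for x
  proof -
    obtain b c' where bc: "b + c' = x" "?T x = alpha_prod \<alpha> (g b) (reflect h c')"
      using alpha_sum_attained[OF \<alpha> g rh] by blast
    have pt: "(f a)\<^sup>2 * G (?T x) \<le> ?F (- b + a) * ?H ((- b + a) + x)" for a
    proof -
      have "(f a)\<^sup>2 * G (?T x) \<le> alpha_prod \<alpha> (f a) (g b) * alpha_prod \<alpha> (f a) (reflect h c')"
        unfolding bc(2)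
        by (intro G C_alpha_nonneg[OF f] C_alpha_le_1[OF f] C_alpha_nonneg[OF g] C_alpha_le_1[OF g]
            C_alpha_nonneg[OF rh] C_alpha_le_1[OF rh])
      also have "\<dots> \<le> ?F (- b + a) * ?H ((- b + a) + x)"
      proof (rule mult_mono)
        show "alpha_prod \<alpha> (f a) (g b) \<le> ?F (- b + a)"
          using alpha_prod_le_alpha_sum[OF \<alpha> f rg, of a "- b"] by (simp add: reflect_def add.commute)
        show "alpha_prod \<alpha> (f a) (reflect h c') \<le> ?H ((- b + a) + x)"
          using alpha_prod_le_alpha_sum[OF \<alpha> f rh, of a c'] bc(1) by (simp add: algebra_simps flip: bc(1))
        show "0 \<le> alpha_prod \<alpha> (f a) (reflect h c')"
          by (intro alpha_prod_nonneg \<alpha> C_alpha_nonneg[OF f] C_alpha_le_1[OF f]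
              C_alpha_nonneg[OF rh] C_alpha_le_1[OF rh])
      qed (rule F0)
      finally show ?thesis .
    qed
    have "(\<integral>\<^sup>+a. ennreal ((f a)\<^sup>2) \<partial>lborel) * ennreal (G (?T x)) = (\<integral>\<^sup>+a. ennreal ((f a)\<^sup>2 * G (?T x)) \<partial>lborel)"
      by (subst nn_integral_multc[symmetric]) (auto simp: ennreal_mult')
    also have "\<dots> \<le> (\<integral>\<^sup>+a. ennreal (?F (- b + a)) * ennreal (?H ((- b + a) + x)) \<partial>lborel)"
      using pt F0 H0 by (intro nn_integral_mono) (auto simp flip: ennreal_mult intro!: ennreal_leI)
    also have "\<dots> = (\<integral>\<^sup>+u. ennreal (?F u) * ennreal (?H (u + x)) \<partial>lborel)"
      by (rule nn_integral_lborel_translate[of "\<lambda>u. ennreal (?F u) * ennreal (?H (u + x))"]) measurable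
    finally show ?thesis .
  qed
  have "(\<integral>\<^sup>+x. ennreal ((f x)\<^sup>2) \<partial>lborel) * (\<integral>\<^sup>+x. ennreal (G (?T x)) \<partial>lborel)
      = (\<integral>\<^sup>+x. (\<integral>\<^sup>+a. ennreal ((f a)\<^sup>2) \<partial>lborel) * ennreal (G (?T x)) \<partial>lborel)"
    by (rule nn_integral_cmult[symmetric]) measurable
  also have "\<dots> \<le> (\<integral>\<^sup>+x. (\<integral>\<^sup>+u. ennreal (?F u) * ennreal (?H (u + x)) \<partial>lborel) \<partial>lborel)"
    by (intro nn_integral_mono fibre)
  also have "\<dots> = (\<integral>\<^sup>+u. (\<integral>\<^sup>+x. ennreal (?F u) * ennreal (?H (u + x)) \<partial>lborel) \<partial>lborel)"
    by (rule lborel_pair.Fubini') measurable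
  also have "\<dots> = (\<integral>\<^sup>+u. ennreal (?F u) * (\<integral>\<^sup>+x. ennreal (?H x) \<partial>lborel) \<partial>lborel)"
  proof (rule nn_integral_cong)
    fix u
    have "(\<integral>\<^sup>+x. ennreal (?F u) * ennreal (?H (u + x)) \<partial>lborel)
        = ennreal (?F u) * (\<integral>\<^sup>+x. ennreal (?H (u + x)) \<partial>lborel)"
      by (rule nn_integral_cmult) measurable
    also have "(\<integral>\<^sup>+x. ennreal (?H (u + x)) \<partial>lborel) = (\<integral>\<^sup>+x. ennreal (?H x) \<partial>lborel)"
      by (rule nn_integral_lborel_translate[of "\<lambda>x. ennreal (?H x)"]) measurable
    finally show "(\<integral>\<^sup>+x. ennreal (?F u) * ennreal (?H (u + x)) \<partial>lborel)
        = ennreal (?F u) * (\<integral>\<^sup>+x. ennreal (?H x) \<partial>lborel)" .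
  qed
  also have "\<dots> = (\<integral>\<^sup>+x. ennreal (?F x) \<partial>lborel) * (\<integral>\<^sup>+x. ennreal (?H x) \<partial>lborel)"
    by (rule nn_integral_multc) measurable
  also have "\<dots> = L1_norm ?F * L1_norm ?H"
    using F0 H0 by (simp add: L1_norm_def)
  finally show ?thesis .
qed

lemma square_powr: "0 < x \<Longrightarrow> (x\<^sup>2) powr a = x powr (2 * a)" for x a :: real
  using powr_powr[of x 2 a] by simp

text \<open>
  With \<open>P, Q, R \<ge> 1\<close> the \<open>\<alpha>\<close>-th powers of \<open>p, q, r\<close>, this is
  \<open>(P + Q - 1) (P + R - 1) \<le> (P (Q + R) / 2)\<^sup>2\<close> raised to the negative power \<open>1 / \<alpha>\<close>. It follows
  from the inequality of arithmetic and geometric means and from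
  \<open>P - 1 + m \<le> P m\<close> for \<open>m = (Q + R) / 2 \<ge> 1\<close>. Since \<open>m = 1 + (Q + R - 2) / 2\<close>, the halving of
  \<open>\<theta>\<close> in the dilated power is exactly what the mean of \<open>Q\<close> and \<open>R\<close> produces.
\<close>

lemma dilated_power_alpha_prod_le:
  assumes \<alpha>: "\<alpha> < 0" and "0 \<le> p" "p \<le> 1" "0 \<le> q" "q \<le> 1" "0 \<le> r" "r \<le> 1"
  shows "p\<^sup>2 * dilated_power \<alpha> (1 / 2) (- 2 / \<alpha>) (alpha_prod \<alpha> q r) \<le> alpha_prod \<alpha> p q * alpha_prod \<alpha> p r"
proof (cases "p = 0 \<or> q = 0 \<or> r = 0")
  case True
  then have "p = 0 \<or> alpha_prod \<alpha> q r = 0" using \<alpha> by (auto simp: alpha_prod_def)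
  moreover have "0 \<le> alpha_prod \<alpha> p q * alpha_prod \<alpha> p r"
    using assms by (intro mult_nonneg_nonneg alpha_prod_nonneg) auto
  ultimately show ?thesis by (auto simp: dilated_power_def)
next
  case False
  then have pos: "0 < p" "0 < q" "0 < r" using assms by auto
  define P Q R where "P = p powr \<alpha>" and "Q = q powr \<alpha>" and "R = r powr \<alpha>"
  have PQR: "P \<ge> 1" "Q \<ge> 1" "R \<ge> 1"
    using pos assms by (auto simp: P_def Q_def R_def intro!: one_le_powr_neg)
  have p2: "p\<^sup>2 = (P\<^sup>2) powr (1 / \<alpha>)"
    using pos \<alpha> by (simp add: P_def square_powr powr_powr)
  have "(P + Q - 1) * (P + R - 1) \<le> (P - 1 + (Q + R) / 2)\<^sup>2"
    using zero_le_power2[of "Q - R"] by (simp add: power2_eq_square field_simps)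
  also have "\<dots> \<le> (P * ((Q + R) / 2))\<^sup>2"
  proof (rule power_mono)
    have lin: "P - 1 + m \<le> P * m" if "m \<ge> 1" for m
      using mult_nonneg_nonneg[of "P - 1" "m - 1"] PQR(1) that by (simp add: algebra_simps)
    show "P - 1 + (Q + R) / 2 \<le> P * ((Q + R) / 2)" by (rule lin) (use PQR in simp)
  qed (use PQR in auto)
  also have "\<dots> = P\<^sup>2 * ((Q + R) / 2)\<^sup>2" by (rule power_mult_distrib)
  finally have le: "(P + Q - 1) * (P + R - 1) \<le> P\<^sup>2 * ((Q + R) / 2)\<^sup>2" .
  have "dilated_power \<alpha> (1 / 2) (- 2 / \<alpha>) (alpha_prod \<alpha> q r) = ((Q + R) / 2) powr (2 / \<alpha>)"
    using alpha_prod_pos[OF \<alpha>, of q r] alpha_prod_powr[OF \<alpha>, of q r] pos assms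
    by (simp add: dilated_power_def Q_def R_def field_simps)
  also have "\<dots> = (((Q + R) / 2)\<^sup>2) powr (1 / \<alpha>)"
    using PQR by (simp add: square_powr)
  finally have "p\<^sup>2 * dilated_power \<alpha> (1 / 2) (- 2 / \<alpha>) (alpha_prod \<alpha> q r)
      = (P\<^sup>2 * ((Q + R) / 2)\<^sup>2) powr (1 / \<alpha>)"
    using PQR by (simp add: p2 powr_mult)
  also have "\<dots> \<le> ((P + Q - 1) * (P + R - 1)) powr (1 / \<alpha>)"
    using le PQR \<alpha> by (intro powr_mono2') auto
  also have "\<dots> = alpha_prod \<alpha> p q * alpha_prod \<alpha> p r"
    using PQR \<alpha> pos by (simp add: alpha_prod_def P_def Q_def R_def powr_mult)
  finally show ?thesis .
qed

text \<open>
  Log-concavity along the segment from \<open>2 x\<close> to 0, where \<open>f\<close> is 1, gives \<open>f (2 x) \<le> (f x)\<^sup>2\<close>.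
\<close>

lemma L1_norm_le_square_log_concave:
  fixes f :: "'a::euclidean_space \<Rightarrow> real"
  assumes f: "f \<in> C_alpha 0"
  shows "L1_norm f \<le> ennreal (2 ^ DIM('a)) * (\<integral>\<^sup>+x. ennreal ((f x)\<^sup>2) \<partial>lborel)"
proof -
  note [measurable] = C_alpha_borel[OF f]
  have "f (2 *\<^sub>R x) \<le> (f x)\<^sup>2" for x
  proof (cases "f (2 *\<^sub>R x) = 0")
    case False
    then have pos: "f (2 *\<^sub>R x) > 0" using C_alpha_nonneg[OF f, of "2 *\<^sub>R x"] by simp
    then have "f (2 *\<^sub>R x) powr (1 / 2) \<le> f x"
      using C_alpha_radial[OF f pos, of "1 / 2"] by (simp add: alpha_mean_def)
    then have "(f (2 *\<^sub>R x) powr (1 / 2))\<^sup>2 \<le> (f x)\<^sup>2" by (intro power_mono) auto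
    then show ?thesis using pos by (simp add: powr_power)
  qed simp
  then have "(\<integral>\<^sup>+x. ennreal (f (2 *\<^sub>R x)) \<partial>lborel) \<le> (\<integral>\<^sup>+x. ennreal ((f x)\<^sup>2) \<partial>lborel)"
    by (intro nn_integral_mono ennreal_leI)
  then show ?thesis
    unfolding L1_norm_def
    by (subst nn_integral_lborel_scaleR[where c = 2]) (auto simp: C_alpha_nonneg[OF f] intro!: mult_left_mono)
qed

theorem theorem6p2:
  fixes \<alpha> :: real and f g h :: "real ^ 'n \<Rightarrow> real"
  assumes "- 1 / real CARD('n) < \<alpha>" and "\<alpha> \<le> 0"
    and "f \<in> C_alpha \<alpha>" and "g \<in> C_alpha \<alpha>" and "h \<in> C_alpha \<alpha>"
  shows "L1_norm f * L1_norm (alpha_sum \<alpha> g (reflect h))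
    \<le> ennreal (1 / 2 ^ CARD('n) * (\<Prod>j = 1..CARD('n). ((2 + real j * \<alpha>) / (1 + real j * \<alpha>))\<^sup>2))
      * L1_norm (alpha_sum \<alpha> f (reflect g)) * L1_norm (alpha_sum \<alpha> f (reflect h))"
proof -
  let ?n = "CARD('n)"
  let ?T = "alpha_sum \<alpha> g (reflect h)"
  define B where "B = (\<Prod>j = 1..?n. (2 + real j * \<alpha>) / (1 + real j * \<alpha>))"
  have T: "?T \<in> C_alpha \<alpha>" by (intro alpha_sum_C_alpha reflect_C_alpha assms)
  have B: "B \<ge> 0"
    unfolding B_def
  proof (rule prod_nonneg)
    fix j assume "j \<in> {1..?n}"
    then have "real j * (- \<alpha>) \<le> real ?n * (- \<alpha>)" using assms(2) by (intro mult_right_mono) auto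
    also have "\<dots> < 1" using assms(1) by (simp add: field_simps)
    finally show "0 \<le> (2 + real j * \<alpha>) / (1 + real j * \<alpha>)" by simp
  qed
  \<comment> \<open>\<open>G\<close> is a dilated power with \<open>c = 1 / 2\<close>; its limit as \<open>\<alpha>\<close> tends to 0 is the identity.\<close>
  obtain G :: "real \<Rightarrow> real" where G: "G \<in> borel_measurable borel"
      "\<And>p q r. \<lbrakk>0 \<le> p; p \<le> 1; 0 \<le> q; q \<le> 1; 0 \<le> r; r \<le> 1\<rbrakk>
        \<Longrightarrow> p\<^sup>2 * G (alpha_prod \<alpha> q r) \<le> alpha_prod \<alpha> p q * alpha_prod \<alpha> p r"
    and f_le: "L1_norm f \<le> ennreal B * (\<integral>\<^sup>+x. ennreal ((f x)\<^sup>2) \<partial>lborel)"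
    and T_le: "L1_norm ?T \<le> ennreal (B / 2 ^ ?n) * (\<integral>\<^sup>+x. ennreal (G (?T x)) \<partial>lborel)"
  proof (cases "\<alpha> = 0")
    case True
    show ?thesis
    proof (rule that[of "\<lambda>t. t"])
      show "L1_norm f \<le> ennreal B * (\<integral>\<^sup>+x. ennreal ((f x)\<^sup>2) \<partial>lborel)"
        using L1_norm_le_square_log_concave[of f] assms(3) by (simp add: True B_def)
      show "L1_norm ?T \<le> ennreal (B / 2 ^ ?n) * (\<integral>\<^sup>+x. ennreal (?T x) \<partial>lborel)"
        using C_alpha_nonneg[OF T] by (simp add: True B_def L1_norm_def)
    qed (auto simp: True alpha_prod_def power2_eq_square)
  next
    case False
    then have \<alpha>: "- 1 / real DIM(real ^ 'n) < \<alpha>" "\<alpha> < 0" using assms(1,2) by auto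
    show ?thesis
    proof (rule that[of "dilated_power \<alpha> (1 / 2) (- 2 / \<alpha>)"])
      have "dilated_power \<alpha> 1 (- 2 / \<alpha>) (f x) = (f x)\<^sup>2" for x
        using C_alpha_nonneg[OF assms(3), of x] \<alpha>(2)
        by (auto simp: dilated_power_def powr_powr)
      then show "L1_norm f \<le> ennreal B * (\<integral>\<^sup>+x. ennreal ((f x)\<^sup>2) \<partial>lborel)"
        using L1_norm_le_dilated_power[OF assms(3) \<alpha>, of 1] by (simp add: B_def)
      show "L1_norm ?T \<le> ennreal (B / 2 ^ ?n)
          * (\<integral>\<^sup>+x. ennreal (dilated_power \<alpha> (1 / 2) (- 2 / \<alpha>) (?T x)) \<partial>lborel)"
        using L1_norm_le_dilated_power[OF T \<alpha>, of "1 / 2"] by (simp add: B_def power_one_over field_simps)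
      show "dilated_power \<alpha> (1 / 2) (- 2 / \<alpha>) \<in> borel_measurable borel"
        unfolding dilated_power_def by measurable
    qed (rule dilated_power_alpha_prod_le[OF \<alpha>(2)])
  qed
  have "L1_norm f * L1_norm ?T
      \<le> (ennreal B * (\<integral>\<^sup>+x. ennreal ((f x)\<^sup>2) \<partial>lborel))
        * (ennreal (B / 2 ^ ?n) * (\<integral>\<^sup>+x. ennreal (G (?T x)) \<partial>lborel))"
    by (intro mult_mono f_le T_le) auto
  also have "\<dots> = ennreal (B * (B / 2 ^ ?n))
      * ((\<integral>\<^sup>+x. ennreal ((f x)\<^sup>2) \<partial>lborel) * (\<integral>\<^sup>+x. ennreal (G (?T x)) \<partial>lborel))"
    by (subst ennreal_mult) (use B in \<open>simp_all only: mult_ac zero_le_divide_iff, simp_all\<close>)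
  also have "\<dots> \<le> ennreal (B * (B / 2 ^ ?n))
      * (L1_norm (alpha_sum \<alpha> f (reflect g)) * L1_norm (alpha_sum \<alpha> f (reflect h)))"
    by (intro mult_left_mono alpha_sum_triangle assms G) auto
  also have "B * (B / 2 ^ ?n) = 1 / 2 ^ ?n * (\<Prod>j = 1..?n. ((2 + real j * \<alpha>) / (1 + real j * \<alpha>))\<^sup>2)"
  proof -
    have "(\<Prod>j = 1..?n. ((2 + real j * \<alpha>) / (1 + real j * \<alpha>))\<^sup>2) = B\<^sup>2"
      unfolding B_def by (simp only: prod_power_distrib)
    then show ?thesis by (simp add: power2_eq_square)
  qed
  finally show ?thesis by (simp add: mult.assoc)
qed

end
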